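(* Let $G$ be a connected Lie group with Lie algebra $\mathfrak{g}=T_eG$, endowed with a left invariant spray structure $\mathbf{G}$ with connection operator $N$. Let $c(t)$ be a smooth curve on $G$ and $Y(t)$ a nowhere vanishing smooth vector field along $c(t)$. Denote $w(t)=(L_{c(t)^{-1}})_*(\dot c(t))\in\mathfrak{g}$ and $y(t)=(L_{c(t)^{-1}})_*(Y(t))\in\mathfrak{g}\backslash\{0\}$. Then $Y(t)$ is nonlinearly parallel along $c(t)$ (with respect to $\mathbf{G}$) if and only if $y(t)$ is a solution of $$\tfrac{\mathrm{d}}{\mathrm{d}t}y(t)+N(y(t),w(t))=0.$$
   Context: Summation convention is used. A spray structure on a smooth manifold $M$ is a smooth vector field $\mathbf{G}$ on the slit tangent bundle $TM\backslash 0$ which, in every standard local coordinate system $(x^i,y^i)$ of $TM$ (i.e. $x=(x^i)\in M$, $y=y^i\partial_{x^i}\in T_xM$), has the form $\mathbf{G}=y^i\partial_{x^i}-2\mathbf{G}^i\partial_{y^i}$ with $\mathbf{G}^i=\mathbf{G}^i(x,y)$ positively 2-homogeneous in $y$. Put $N^i_j=\partial\mathbf{G}^i/\partial y^j$. Nonlinear parallelism: for a smooth curve $c(t)$ and a nowhere vanishing smooth vector field $Y(t)=z^i(t)\partial_{x^i}|_{c(t)}$ along it, the nonlinearly covariant derivative is $\widetilde D_{\dot c(t)}Y(t)=\big(\tfrac{\mathrm{d}z^i(t)}{\mathrm{d}t}+\dot c^j(t)N^i_j(c(t),Y(t))\big)\partial_{x^i}|_{c(t)}$, and $Y(t)$ is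 nonlinearly parallel along $c(t)$ if $\widetilde D_{\dot c(t)}Y(t)\equiv0$. Lie group notation: $L_g(g')=gg'$; $[\cdot,\cdot]_{\mathfrak{g}}$ is the Lie bracket of $\mathfrak{g}$ (defined through left invariant vector fields). Fix a basis $e_1,\dots,e_n$ of $\mathfrak{g}$ and let $U_i(g)=(L_g)_*(e_i)$. Let $\widetilde U_i$ be the complete lift of $U_i$ to $TG$ (the complete lift of $X=X^i\partial_{x^i}$ is $X^i\partial_{x^i}+y^j\tfrac{\partial X^i}{\partial x^j}\partial_{y^i}$). Writing $y=u^iU_i(g)\in T_gG$ defines functions $u^i$ on $TG$, and $\partial_{u^i}$ denotes the vector field on $TG$ tangent to each $T_gG$ and equal there to the coordinate field of the linear coordinate $u^i$. Left invariant sprays: $\mathbf{G}$ on $G$ is left invariant if it is preserved by (the maps on $TG\backslash 0$ induced by) all left translations. Put $\mathbf{G}_0=u^i\widetilde U_i$. Every left invariant spray structure can be written $\mathbf{G}=\mathbf{G}_0-\mathbf{H}^i\partial_{u^i}$, where the $\mathbf{H}^i$ are left invariant smooth functions on $TG\backslash 0$, positively 2-homogeneous on each $T_gG$. The spray vector field is the smooth map $\eta:\mathfrak{g}\backslash\{0\}\to\mathfrak{g}$, $\eta(y)=\mathbf{H}^i(e,y)e_i$. The connection operator is $N:(\mathfrak{g}\backslash\{0\})\times\mathfrak{g}\to\mathfrak{g}$, $N(y,w)=\tfrac12D\eta(y,w)-\tfrac12[y,w]_{\mathfrak{g}}$, where $D\eta(y,w)$ is the derivative of $\eta$ at $y$ in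 the direction $w$. *)

theory Defs
  imports "HOL-Analysis.Analysis" "HOL-Library.Function_Algebras" "HOL-Algebra.Group"
begin

instantiation "fun" :: (type, real_vector) real_vector
begin

definition scaleR_fun :: "real \<Rightarrow> ('a \<Rightarrow> 'b) \<Rightarrow> 'a \<Rightarrow> 'b"
  where "scaleR_fun r f = (\<lambda>x. r *\<^sub>R f x)"

instance
  by standard (simp_all add: scaleR_fun_def fun_eq_iff algebra_simps)

end


section \<open>Smooth functions between Euclidean spaces\<close>

primrec Ck_on ::
  "nat \<Rightarrow> 'a::euclidean_space set \<Rightarrow> ('a \<Rightarrow> 'b::euclidean_space) \<Rightarrow> bool"
where
  "Ck_on 0 W f \<longleftrightarrow> continuous_on W f"
| "Ck_on (Suc k) W f \<longleftrightarrow>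
     (\<forall>x\<in>W. f differentiable (at x)) \<and> (\<forall>v. Ck_on k W (\<lambda>x. frechet_derivative f (at x) v))"

text \<open>Only used for open \<^term>\<open>W\<close>.\<close>

definition smooth_on :: "'a::euclidean_space set \<Rightarrow> ('a \<Rightarrow> 'b::euclidean_space) \<Rightarrow> bool"
  where "smooth_on W f \<longleftrightarrow> (\<forall>k. Ck_on k W f)"


section \<open>Smooth manifolds\<close>

text \<open>A chart is a pair of its domain and its coordinate map; the values of the map outside the
  domain are irrelevant. A manifold is given by an atlas, its points are the points covered by the
  charts, and its topology is the one induced by the charts.\<close>

type_synonym ('a, 'e) chart = "'a set \<times> ('a \<Rightarrow> 'e)"

definition chart_inv :: "('a, 'e) chart \<Rightarrow> 'e \<Rightarrow> 'a"
  where "chart_inv c = inv_into (fst c) (snd c)"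

definition is_chart :: "('a, 'e::euclidean_space) chart \<Rightarrow> bool"
  where "is_chart c \<longleftrightarrow> inj_on (snd c) (fst c) \<and> open (snd c ` fst c)"

definition smooth_transition ::
  "('a, 'e::euclidean_space) chart \<Rightarrow> ('a, 'e) chart \<Rightarrow> bool"
where
  "smooth_transition c d \<longleftrightarrow>
     open (snd c ` (fst c \<inter> fst d)) \<and>
     smooth_on (snd c ` (fst c \<inter> fst d)) (snd d \<circ> chart_inv c)"

definition compatible :: "('a, 'e::euclidean_space) chart \<Rightarrow> ('a, 'e) chart \<Rightarrow> bool"
  where "compatible c d \<longleftrightarrow> smooth_transition c d \<and> smooth_transition d c"

definition points :: "('a, 'e) chart set \<Rightarrow> 'a set"
  where "points A = (\<Union>c\<in>A. fst c)"

definition smooth_atlas :: "('a, 'e::euclidean_space) chart set \<Rightarrow> bool"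
  where "smooth_atlas A \<longleftrightarrow> (\<forall>c\<in>A. is_chart c) \<and> (\<forall>c\<in>A. \<forall>d\<in>A. compatible c d)"

definition atlas_topology :: "('a, 'e::euclidean_space) chart set \<Rightarrow> 'a topology"
  where "atlas_topology A =
    topology (\<lambda>W. W \<subseteq> points A \<and> (\<forall>c\<in>A. open (snd c ` (fst c \<inter> W))))"

lemma openin_atlas_topology:
  assumes "smooth_atlas A"
  shows "openin (atlas_topology A) W \<longleftrightarrow>
    W \<subseteq> points A \<and> (\<forall>c\<in>A. open (snd c ` (fst c \<inter> W)))"
proof -
  have "istopology (\<lambda>W. W \<subseteq> points A \<and> (\<forall>c\<in>A. open (snd c ` (fst c \<inter> W))))"
    unfolding istopology_def
  proof (intro conjI allI impI ballI; (elim conjE)?)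
    fix V W c
    assume c: "c \<in> A"
      and V: "\<forall>c\<in>A. open (snd c ` (fst c \<inter> V))" and W: "\<forall>c\<in>A. open (snd c ` (fst c \<inter> W))"
    have "inj_on (snd c) (fst c)"
      using assms c by (simp add: smooth_atlas_def is_chart_def)
    then have "snd c ` (fst c \<inter> (V \<inter> W)) = snd c ` (fst c \<inter> V) \<inter> snd c ` (fst c \<inter> W)"
      by (auto simp: inj_on_def)
    then show "open (snd c ` (fst c \<inter> (V \<inter> W)))"
      using V W c by auto
  next
    fix \<K> c
    assume c: "c \<in> A"
      and K: "\<forall>K\<in>\<K>. K \<subseteq> points A \<and> (\<forall>c\<in>A. open (snd c ` (fst c \<inter> K)))"
    have "snd c ` (fst c \<inter> \<Union>\<K>) = (\<Union>K\<in>\<K>. snd c ` (fst c \<inter> K))"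
      by blast
    then show "open (snd c ` (fst c \<inter> \<Union>\<K>))"
      using K c by auto
  qed auto
  then show ?thesis
    unfolding atlas_topology_def by simp
qed

definition maximal_atlas :: "('a, 'e::euclidean_space) chart set \<Rightarrow> bool"
  where "maximal_atlas A \<longleftrightarrow> smooth_atlas A \<and>
    (\<forall>c. is_chart c \<and> fst c \<subseteq> points A \<and> (\<forall>d\<in>A. compatible c d) \<longrightarrow> c \<in> A)"

definition smooth_manifold :: "('a, 'e::euclidean_space) chart set \<Rightarrow> bool"
  where "smooth_manifold A \<longleftrightarrow> maximal_atlas A \<and>
    Hausdorff_space (atlas_topology A) \<and> second_countable (atlas_topology A)"

text \<open>Openness of the sets on which the coordinate expressions live is continuity.\<close>

definition smooth_map ::
  "('a, 'd::euclidean_space) chart set \<Rightarrow> ('b, 'e::euclidean_space) chart set \<Rightarrow> ('a \<Rightarrow> 'b) \<Rightarrow> bool"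
where
  "smooth_map A B f \<longleftrightarrow> f ` points A \<subseteq> points B \<and>
     (\<forall>c\<in>A. \<forall>d\<in>B. open (snd c ` (fst c \<inter> f -` fst d)) \<and>
        smooth_on (snd c ` (fst c \<inter> f -` fst d)) (snd d \<circ> f \<circ> chart_inv c))"

definition prod_atlas ::
  "('a, 'd) chart set \<Rightarrow> ('b, 'e) chart set \<Rightarrow> ('a \<times> 'b, 'd \<times> 'e) chart set"
where
  "prod_atlas A B = {(fst c \<times> fst d, map_prod (snd c) (snd d)) | c d. c \<in> A \<and> d \<in> B}"

text \<open>The standard atlas of an open interval of the real line (not maximal).\<close>

definition interval_atlas :: "real set \<Rightarrow> (real, real) chart set"
  where "interval_atlas I = {(I, \<lambda>t. t)}"


section \<open>Tangent vectors\<close>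

text \<open>A tangent vector at \<open>p\<close> is the family of its components in all charts around \<open>p\<close>
  (the component in chart \<open>c\<close> collects the coefficients \<open>y\<^sup>i\<close> of \<open>y\<^sup>i \<partial>/\<partial>x\<^sup>i\<close>), transforming by the
  derivatives of the coordinate changes; it is padded with zero for all other charts, so that
  the vector space operations are pointwise.\<close>

type_synonym ('a, 'e) tvec = "('a, 'e) chart \<Rightarrow> 'e"

definition charts_at :: "('a, 'e) chart set \<Rightarrow> 'a \<Rightarrow> ('a, 'e) chart set"
  where "charts_at A p = {c \<in> A. p \<in> fst c}"

definition tangent_space ::
  "('a, 'e::euclidean_space) chart set \<Rightarrow> 'a \<Rightarrow> ('a, 'e) tvec set"
where
  "tangent_space A p = {\<xi>. (\<forall>c. c \<notin> charts_at A p \<longrightarrow> \<xi> c = 0) \<and>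
     (\<forall>c\<in>charts_at A p. \<forall>d\<in>charts_at A p.
        \<xi> d = frechet_derivative (snd d \<circ> chart_inv c) (at (snd c p)) (\<xi> c))}"

text \<open>The differential \<open>f\<^sub>* : T\<^sub>p M \<rightarrow> T\<^bsub>f(p)\<^esub> N\<close>. The choice of the chart \<open>c\<close> at \<open>p\<close> is immaterial.\<close>

definition pushforward ::
  "('a, 'd::euclidean_space) chart set \<Rightarrow> ('b, 'e::euclidean_space) chart set \<Rightarrow> ('a \<Rightarrow> 'b) \<Rightarrow>
   'a \<Rightarrow> ('a, 'd) tvec \<Rightarrow> ('b, 'e) tvec"
where
  "pushforward A B f p \<xi> = (\<lambda>d. if d \<in> charts_at B (f p)
     then (let c = (SOME c. c \<in> charts_at A p)
           in frechet_derivative (snd d \<circ> f \<circ> chart_inv c) (at (snd c p)) (\<xi> c))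
     else 0)"

definition velocity ::
  "('a, 'e::euclidean_space) chart set \<Rightarrow> (real \<Rightarrow> 'a) \<Rightarrow> real \<Rightarrow> ('a, 'e) tvec"
where
  "velocity A \<gamma> t = (\<lambda>c. if c \<in> charts_at A (\<gamma> t)
     then vector_derivative (\<lambda>s. snd c (\<gamma> s)) (at t) else 0)"

definition in_chart :: "('a, 'e) chart \<Rightarrow> ('a \<Rightarrow> ('a, 'e) tvec) \<Rightarrow> 'e \<Rightarrow> 'e"
  where "in_chart c X x = X (chart_inv c x) c"

definition smooth_vector_field ::
  "('a, 'e::euclidean_space) chart set \<Rightarrow> ('a \<Rightarrow> ('a, 'e) tvec) \<Rightarrow> bool"
where
  "smooth_vector_field A X \<longleftrightarrow>
     (\<forall>p\<in>points A. X p \<in> tangent_space A p) \<and> (\<forall>c\<in>A. smooth_on (snd c ` fst c) (in_chart c X))"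

text \<open>\<open>[X,Y]\<^sup>i = X\<^sup>j \<partial>Y\<^sup>i/\<partial>x\<^sup>j - Y\<^sup>j \<partial>X\<^sup>i/\<partial>x\<^sup>j\<close> in every chart.\<close>

definition lie_bracket ::
  "('a, 'e::euclidean_space) chart set \<Rightarrow> ('a \<Rightarrow> ('a, 'e) tvec) \<Rightarrow> ('a \<Rightarrow> ('a, 'e) tvec) \<Rightarrow>
   'a \<Rightarrow> ('a, 'e) tvec"
where
  "lie_bracket A X Y p = (\<lambda>c. if c \<in> charts_at A p
     then frechet_derivative (in_chart c Y) (at (snd c p)) (X p c)
        - frechet_derivative (in_chart c X) (at (snd c p)) (Y p c)
     else 0)"


section \<open>The slit tangent bundle and sprays\<close>

text \<open>The points of the slit tangent bundle are pairs \<open>(p, \<xi>)\<close> with \<open>\<xi>\<close> a nonzero tangent vector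
  at \<open>p\<close>. The chart \<open>c\<close> induces the standard local coordinates \<open>(x\<^sup>i, y\<^sup>i)\<close>.\<close>

definition slit_chart ::
  "('a, 'e::euclidean_space) chart set \<Rightarrow> ('a, 'e) chart \<Rightarrow> ('a \<times> ('a, 'e) tvec, 'e \<times> 'e) chart"
where
  "slit_chart A c =
     ({(p, \<xi>). p \<in> fst c \<and> \<xi> \<in> tangent_space A p \<and> \<xi> \<noteq> 0}, \<lambda>(p, \<xi>). (snd c p, \<xi> c))"

definition slit_atlas ::
  "('a, 'e::euclidean_space) chart set \<Rightarrow> ('a \<times> ('a, 'e) tvec, 'e \<times> 'e) chart set"
where
  "slit_atlas A = slit_chart A ` A"

definition tangent_map ::
  "('a, 'd::euclidean_space) chart set \<Rightarrow> ('b, 'e::euclidean_space) chart set \<Rightarrow> ('a \<Rightarrow> 'b) \<Rightarrow>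
   'a \<times> ('a, 'd) tvec \<Rightarrow> 'b \<times> ('b, 'e) tvec"
where
  "tangent_map A B f v = (f (fst v), pushforward A B f (fst v) (snd v))"

text \<open>Vector fields on the slit tangent bundle.\<close>

type_synonym ('a, 'e) slit_field =
  "'a \<times> ('a, 'e) tvec \<Rightarrow> ('a \<times> ('a, 'e) tvec, 'e \<times> 'e) tvec"

text \<open>The functions \<open>G\<^sup>i(x, y)\<close> in the chart \<open>c\<close>.\<close>

definition spray_coeff ::
  "('a, 'e::euclidean_space) chart set \<Rightarrow> ('a, 'e) slit_field \<Rightarrow> ('a, 'e) chart \<Rightarrow> 'e \<Rightarrow> 'e \<Rightarrow> 'e"
where
  "spray_coeff A S c x y = - (1/2) *\<^sub>R snd (in_chart (slit_chart A c) S (x, y))"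

definition spray_structure ::
  "('a, 'e::euclidean_space) chart set \<Rightarrow> ('a, 'e) slit_field \<Rightarrow> bool"
where
  "spray_structure A S \<longleftrightarrow> smooth_vector_field (slit_atlas A) S \<and>
     (\<forall>c\<in>A. \<forall>x\<in>snd c ` fst c. \<forall>y. y \<noteq> 0 \<longrightarrow>
        fst (in_chart (slit_chart A c) S (x, y)) = y \<and>
        (\<forall>r>0. spray_coeff A S c x (r *\<^sub>R y) = r\<^sup>2 *\<^sub>R spray_coeff A S c x y))"

text \<open>\<open>N\<^sup>i\<^sub>j = \<partial>G\<^sup>i/\<partial>y\<^sup>j\<close>.\<close>

definition spray_N ::
  "('a, real^'n) chart set \<Rightarrow> ('a, real^'n) slit_field \<Rightarrow> ('a, real^'n) chart \<Rightarrow>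
   real^'n \<Rightarrow> real^'n \<Rightarrow> 'n \<Rightarrow> 'n \<Rightarrow> real"
where
  "spray_N A S c x y i j =
     frechet_derivative (\<lambda>y'. spray_coeff A S c x y' $ i) (at y) (axis j 1)"

text \<open>Components, in every chart around \<open>\<gamma>(t)\<close>, of the nonlinearly covariant derivative of \<open>Y\<close>
  along \<open>\<gamma>\<close>.\<close>

definition nonlinear_covariant_deriv ::
  "('a, real^'n) chart set \<Rightarrow> ('a, real^'n) slit_field \<Rightarrow> (real \<Rightarrow> 'a) \<Rightarrow>
   (real \<Rightarrow> ('a, real^'n) tvec) \<Rightarrow> real \<Rightarrow> ('a, real^'n) tvec"
where
  "nonlinear_covariant_deriv A S \<gamma> Y t = (\<lambda>c. if c \<in> charts_at A (\<gamma> t)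
     then (\<chi> i. deriv (\<lambda>s. Y s c $ i) t
             + (\<Sum>j\<in>UNIV. velocity A \<gamma> t c $ j * spray_N A S c (snd c (\<gamma> t)) (Y t c) i j))
     else 0)"

definition nonlinearly_parallel ::
  "('a, real^'n) chart set \<Rightarrow> ('a, real^'n) slit_field \<Rightarrow> real set \<Rightarrow> (real \<Rightarrow> 'a) \<Rightarrow>
   (real \<Rightarrow> ('a, real^'n) tvec) \<Rightarrow> bool"
where
  "nonlinearly_parallel A S I \<gamma> Y \<longleftrightarrow> (\<forall>t\<in>I. nonlinear_covariant_deriv A S \<gamma> Y t = 0)"

definition smooth_curve ::
  "('a, 'e::euclidean_space) chart set \<Rightarrow> real set \<Rightarrow> (real \<Rightarrow> 'a) \<Rightarrow> bool"
where
  "smooth_curve A I \<gamma> \<longleftrightarrow> smooth_map (interval_atlas I) A \<gamma>"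

definition smooth_nonvanishing_field_along ::
  "('a, 'e::euclidean_space) chart set \<Rightarrow> real set \<Rightarrow> (real \<Rightarrow> 'a) \<Rightarrow>
   (real \<Rightarrow> ('a, 'e) tvec) \<Rightarrow> bool"
where
  "smooth_nonvanishing_field_along A I \<gamma> Y \<longleftrightarrow>
     (\<forall>t\<in>I. Y t \<in> tangent_space A (\<gamma> t) \<and> Y t \<noteq> 0) \<and>
     smooth_map (interval_atlas I) (slit_atlas A) (\<lambda>t. (\<gamma> t, Y t))"

text \<open>In the standard coordinates of the chart \<open>c\<close> the complete lift of \<open>X\<close> is
  \<open>X\<^sup>i \<partial>/\<partial>x\<^sup>i + y\<^sup>j (\<partial>X\<^sup>i/\<partial>x\<^sup>j) \<partial>/\<partial>y\<^sup>i\<close>. The map \<^term>\<open>slit_chart A\<close> is injective, so \<open>c\<close> is determined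
  by the chart of the bundle. Only the restriction of the lift to the slit bundle is needed.\<close>

definition complete_lift ::
  "('a, 'e::euclidean_space) chart set \<Rightarrow> ('a \<Rightarrow> ('a, 'e) tvec) \<Rightarrow> ('a, 'e) slit_field"
where
  "complete_lift A X v = (\<lambda>k. if k \<in> charts_at (slit_atlas A) v
     then (let c = the_inv_into A (slit_chart A) k
           in (X (fst v) c, frechet_derivative (in_chart c X) (at (snd c (fst v))) (snd v c)))
     else 0)"


section \<open>Lie groups and left invariant sprays\<close>

definition lie_group :: "('g, 'm) monoid_scheme \<Rightarrow> ('g, 'e::euclidean_space) chart set \<Rightarrow> bool"
  where "lie_group G A \<longleftrightarrow> group G \<and> smooth_manifold A \<and> points A = carrier G \<and>
    smooth_map (prod_atlas A A) A (\<lambda>(g, h). g \<otimes>\<^bsub>G\<^esub> h) \<and>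
    smooth_map A A (\<lambda>g. inv\<^bsub>G\<^esub> g)"

definition left_translation :: "('g, 'm) monoid_scheme \<Rightarrow> 'g \<Rightarrow> 'g \<Rightarrow> 'g"
  where "left_translation G g h = g \<otimes>\<^bsub>G\<^esub> h"

definition left_invariant_spray ::
  "('g, 'm) monoid_scheme \<Rightarrow> ('g, 'e::euclidean_space) chart set \<Rightarrow> ('g, 'e) slit_field \<Rightarrow> bool"
where
  "left_invariant_spray G A S \<longleftrightarrow> spray_structure A S \<and>
     (\<forall>g\<in>carrier G. \<forall>v\<in>points (slit_atlas A).
        pushforward (slit_atlas A) (slit_atlas A) (tangent_map A A (left_translation G g)) v (S v)
        = S (tangent_map A A (left_translation G g) v))"

definition lie_algebra ::
  "('g, 'm) monoid_scheme \<Rightarrow> ('g, 'e::euclidean_space) chart set \<Rightarrow> ('g, 'e) tvec set"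
where
  "lie_algebra G A = tangent_space A \<one>\<^bsub>G\<^esub>"

definition left_invariant_field ::
  "('g, 'm) monoid_scheme \<Rightarrow> ('g, 'e::euclidean_space) chart set \<Rightarrow> ('g, 'e) tvec \<Rightarrow>
   'g \<Rightarrow> ('g, 'e) tvec"
where
  "left_invariant_field G A \<xi> g = pushforward A A (left_translation G g) \<one>\<^bsub>G\<^esub> \<xi>"

definition lie_algebra_bracket ::
  "('g, 'm) monoid_scheme \<Rightarrow> ('g, 'e::euclidean_space) chart set \<Rightarrow>
   ('g, 'e) tvec \<Rightarrow> ('g, 'e) tvec \<Rightarrow> ('g, 'e) tvec"
where
  "lie_algebra_bracket G A y w =
     lie_bracket A (left_invariant_field G A y) (left_invariant_field G A w) \<one>\<^bsub>G\<^esub>"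

definition lie_algebra_basis ::
  "('g, 'm) monoid_scheme \<Rightarrow> ('g, real^'n) chart set \<Rightarrow> ('n \<Rightarrow> ('g, real^'n) tvec) \<Rightarrow> bool"
where
  "lie_algebra_basis G A e \<longleftrightarrow>
     inj e \<and> independent (range e) \<and> span (range e) = lie_algebra G A"

definition frame ::
  "('g, 'm) monoid_scheme \<Rightarrow> ('g, real^'n) chart set \<Rightarrow> ('n \<Rightarrow> ('g, real^'n) tvec) \<Rightarrow>
   'n \<Rightarrow> 'g \<Rightarrow> ('g, real^'n) tvec"
where
  "frame G A e i = left_invariant_field G A (e i)"

definition frame_coords ::
  "('g, 'm) monoid_scheme \<Rightarrow> ('g, real^'n) chart set \<Rightarrow> ('n \<Rightarrow> ('g, real^'n) tvec) \<Rightarrow>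
   'g \<times> ('g, real^'n) tvec \<Rightarrow> real^'n"
where
  "frame_coords G A e v = (THE u. snd v = (\<Sum>i\<in>UNIV. u $ i *\<^sub>R frame G A e i (fst v)))"

text \<open>\<open>\<partial>\<^bsub>u\<^sup>i\<^esub>\<close> at \<open>(g, y)\<close>: the velocity of the coordinate line \<open>s \<mapsto> y + s U\<^sub>i(g)\<close> in the fibre over \<open>g\<close>.\<close>

definition frame_vertical ::
  "('g, 'm) monoid_scheme \<Rightarrow> ('g, real^'n) chart set \<Rightarrow> ('n \<Rightarrow> ('g, real^'n) tvec) \<Rightarrow>
   'n \<Rightarrow> ('g, real^'n) slit_field"
where
  "frame_vertical G A e i v =
     velocity (slit_atlas A) (\<lambda>s. (fst v, snd v + s *\<^sub>R frame G A e i (fst v))) 0"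

definition canonical_spray ::
  "('g, 'm) monoid_scheme \<Rightarrow> ('g, real^'n) chart set \<Rightarrow> ('n \<Rightarrow> ('g, real^'n) tvec) \<Rightarrow>
   ('g, real^'n) slit_field"
where
  "canonical_spray G A e v =
     (\<Sum>i\<in>UNIV. frame_coords G A e v $ i *\<^sub>R complete_lift A (frame G A e i) v)"

text \<open>The functions \<open>H\<^sup>i\<close>, determined by \<open>S = G\<^sub>0 - H\<^sup>i \<partial>\<^bsub>u\<^sup>i\<^esub>\<close>.\<close>

definition spray_H ::
  "('g, 'm) monoid_scheme \<Rightarrow> ('g, real^'n) chart set \<Rightarrow> ('n \<Rightarrow> ('g, real^'n) tvec) \<Rightarrow>
   ('g, real^'n) slit_field \<Rightarrow> 'g \<times> ('g, real^'n) tvec \<Rightarrow> real^'n"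
where
  "spray_H G A e S v = (THE h.
     S v = canonical_spray G A e v - (\<Sum>i\<in>UNIV. h $ i *\<^sub>R frame_vertical G A e i v))"

definition spray_vector_field ::
  "('g, 'm) monoid_scheme \<Rightarrow> ('g, real^'n) chart set \<Rightarrow> ('n \<Rightarrow> ('g, real^'n) tvec) \<Rightarrow>
   ('g, real^'n) slit_field \<Rightarrow> ('g, real^'n) tvec \<Rightarrow> ('g, real^'n) tvec"
where
  "spray_vector_field G A e S y = (\<Sum>i\<in>UNIV. spray_H G A e S (\<one>\<^bsub>G\<^esub>, y) $ i *\<^sub>R e i)"

text \<open>Curves in a fixed tangent space, such as the Lie algebra, are differentiated componentwise:
  the component in a chart is a linear coordinate system of that tangent space.\<close>

definition has_tvec_derivative ::
  "(real \<Rightarrow> ('a, 'e::euclidean_space) tvec) \<Rightarrow> ('a, 'e) tvec \<Rightarrow> real \<Rightarrow> bool"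
where
  "has_tvec_derivative y \<eta> t \<longleftrightarrow> (\<forall>c. ((\<lambda>s. y s c) has_vector_derivative \<eta> c) (at t))"

definition tvec_derivative ::
  "(real \<Rightarrow> ('a, 'e::euclidean_space) tvec) \<Rightarrow> real \<Rightarrow> ('a, 'e) tvec"
where
  "tvec_derivative y t = (\<lambda>c. vector_derivative (\<lambda>s. y s c) (at t))"

definition connection_operator ::
  "('g, 'm) monoid_scheme \<Rightarrow> ('g, real^'n) chart set \<Rightarrow> ('n \<Rightarrow> ('g, real^'n) tvec) \<Rightarrow>
   ('g, real^'n) slit_field \<Rightarrow> ('g, real^'n) tvec \<Rightarrow> ('g, real^'n) tvec \<Rightarrow> ('g, real^'n) tvec"
where
  "connection_operator G A e S y w =
     (1/2) *\<^sub>R tvec_derivative (\<lambda>s. spray_vector_field G A e S (y + s *\<^sub>R w)) 0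
     - (1/2) *\<^sub>R lie_algebra_bracket G A y w"

end

theory Submission
  imports Defs
begin

text \<open>Fix \<open>t\<close> and put \<open>g = c(t)\<close>. A chart \<open>k\<close> around \<open>g\<close> and the chart \<open>d = k \<circ> L\<^sub>g\<close> around the identity turn
  \<open>L\<^sub>g\<close> into the identity map, so left invariance says that left invariant fields and the spray
  coefficients have the same expressions in \<open>k\<close> and \<open>d\<close>, and no change of coordinates is needed. Let
  \<open>\<Phi>(x) v\<close> be the expression in \<open>d\<close> of the left invariant field with value \<open>v\<close> at the identity \<open>x\<^sub>0\<close>, and
  \<open>K(v, a)\<close> its derivative at \<open>x\<^sub>0\<close> in the direction \<open>a\<close>. Then \<open>[y, w] = K(w, y) - K(y, w)\<close> and
  \<open>\<eta>(y) = 2 G(x\<^sub>0, y) + K(y, y)\<close>, whence \<open>N(y, w) = D\<^sub>y G(w) + K(y, w)\<close>. On the other hand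
  \<open>Y = \<Phi>(c) y\<close> along the curve and \<open>\<Phi>(x\<^sub>0) = id\<close> give \<open>Y' = y' + K(y, w)\<close> at \<open>t\<close>, so the nonlinearly
  covariant derivative \<open>Y' + D\<^sub>y G(w)\<close> in \<open>k\<close> is \<open>y' + N(y, w)\<close> in \<open>d\<close>. That the functions \<open>H\<^sup>i\<close> exist
  needs the complete lift to be a vector field, that is, the symmetry of second derivatives.\<close>

section \<open>Smooth functions and their derivatives\<close>

text \<open>\<open>nonlinear_covariant_deriv\<close> is defined chart by chart. Instead of proving a
  transformation law for it, the proof tests its vanishing in every chart: translation by
  \<open>c t\<close> matches the charts around the identity with the charts around
  \<open>c t\<close>, so letting \<open>d\<close> run over the former lets \<open>k\<close> run over
  the latter, and one family of components vanishes if and only if the other does.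

  Only \<open>Y\<close> is assumed smooth, so differentiability of \<open>y\<close> has to be
  derived. Because Phi is the identity at the base point, its matrix along the curve is invertible
  near \<open>t\<close>, and solving Y = Phi(c) y for \<open>y\<close> gives differentiability and
  the derivative at once.

  Two choices have to be eliminated. \<open>pushforward\<close> selects some chart; the chain rule
  shows that any other gives the same components. \<open>spray_H\<close> is a definite description;
  its defining equation is an identity between tangent vectors of the slit bundle with equal
  horizontal parts, so it can be decided by the vertical part in a single chart, where the basis of
  the Lie algebra gives existence and uniqueness.\<close>

lemma Ck_on_cong:
  assumes "open W" "\<And>x. x \<in> W \<Longrightarrow> f x = g x" "Ck_on k W f"
  shows "Ck_on k W g"
  using assms(2,3)
proof (induction k arbitrary: f g)
  case 0
  then show ?case by (simp cong: continuous_on_cong)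
next
  case (Suc k)
  have D: "f differentiable (at x)" if "x \<in> W" for x
    using Suc.prems(2) that by simp
  have eq: "frechet_derivative f (at x) v = frechet_derivative g (at x) v" if "x \<in> W" for x v
    using frechet_derivative_transform_within_open[OF D[OF that] assms(1) that Suc.prems(1)] by simp
  show ?case
  proof (simp, intro conjI ballI allI)
    fix x assume "x \<in> W"
    then show "g differentiable (at x)"
      using D[of x] Suc.prems(1) assms(1) has_derivative_transform_within_open
      unfolding differentiable_def by metis
  next
    fix v
    show "Ck_on k W (\<lambda>x. frechet_derivative g (at x) v)"
      using Suc.IH[OF eq] Suc.prems(2) by simp
  qed
qed

lemma smooth_on_cong:
  assumes "open W" "\<And>x. x \<in> W \<Longrightarrow> f x = g x" "smooth_on W f"
  shows "smooth_on W g"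
  using assms Ck_on_cong unfolding smooth_on_def by blast

lemma smooth_on_differentiable:
  assumes "smooth_on W f" "x \<in> W"
  shows "f differentiable (at x)"
  using assms(1)[unfolded smooth_on_def, rule_format, of 1] assms(2) by simp

lemma smooth_on_has_derivative:
  assumes "smooth_on W f" "x \<in> W"
  shows "(f has_derivative frechet_derivative f (at x)) (at x)"
  using smooth_on_differentiable[OF assms] by (simp add: frechet_derivative_works)

lemma smooth_on_linear_derivative:
  assumes "smooth_on W f" "x \<in> W"
  shows "linear (frechet_derivative f (at x))"
  using smooth_on_differentiable[OF assms] by (rule linear_frechet_derivative)

lemma smooth_on_derivative:
  assumes "smooth_on W f"
  shows "smooth_on W (\<lambda>x. frechet_derivative f (at x) v)"
  unfolding smooth_on_def
proof
  fix k
  show "Ck_on k W (\<lambda>x. frechet_derivative f (at x) v)"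
    using assms[unfolded smooth_on_def, rule_format, of "Suc k"] by simp
qed

lemma smooth_on_continuous_on:
  assumes "smooth_on W f"
  shows "continuous_on W f"
  using assms[unfolded smooth_on_def, rule_format, of 0] by simp

section \<open>Functions of two variables with the first one frozen\<close>

lemma frechet_derivative_slice:
  fixes f :: "'a::euclidean_space \<times> 'b::euclidean_space \<Rightarrow> 'c::euclidean_space"
  assumes "f differentiable (at (a, x))"
  shows "((\<lambda>x. f (a, x)) has_derivative (\<lambda>v. frechet_derivative f (at (a, x)) (0, v))) (at x)"
proof -
  have "(Pair a has_derivative (\<lambda>v. (0, v))) (at x)"
    by (auto intro!: derivative_eq_intros)
  from has_derivative_compose[OF this, of f] show ?thesis
    using assms by (simp add: frechet_derivative_works)
qed

lemma open_slice:
  assumes "open W"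
  shows "open {x. (a, x) \<in> W}"
  using open_vimage[OF assms, of "Pair a"] by (simp add: vimage_def continuous_on_Pair)

text \<open>The derivative of a slice in the direction \<open>v\<close> is the slice of the
  derivative in the direction \<open>(0, v)\<close>, so the induction hypothesis applies to it. This
  is later applied to the group product to obtain left translations.\<close>

lemma Ck_on_slice:
  fixes f :: "'a::euclidean_space \<times> 'b::euclidean_space \<Rightarrow> 'c::euclidean_space"
  assumes "open W" "Ck_on k W f"
  shows "Ck_on k {x. (a, x) \<in> W} (\<lambda>x. f (a, x))"
  using assms(2)
proof (induction k arbitrary: f)
  case 0
  then show ?case
    by (auto intro!: continuous_on_compose2[of W f] continuous_intros)
next
  case (Suc k)
  note op = open_slice[OF assms(1)]
  have D: "f differentiable (at (a, x))" if "(a, x) \<in> W" for x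
    using Suc.prems that by auto
  have H: "((\<lambda>x. f (a, x)) has_derivative (\<lambda>v. frechet_derivative f (at (a, x)) (0, v))) (at x)"
    if "(a, x) \<in> W" for x
    by (rule frechet_derivative_slice[OF D[OF that]])
  have eq: "frechet_derivative f (at (a, x)) (0, v) = frechet_derivative (\<lambda>x. f (a, x)) (at x) v"
    if "x \<in> {x. (a, x) \<in> W}" for x v
    using frechet_derivative_at[OF H[of x]] that by (metis mem_Collect_eq)
  show ?case
  proof (simp, intro conjI allI impI)
    fix x assume "(a, x) \<in> W"
    then show "(\<lambda>x. f (a, x)) differentiable (at x)"
      using H differentiable_def by blast
  next
    fix v
    have "Ck_on k {x. (a, x) \<in> W} (\<lambda>x. frechet_derivative f (at (a, x)) (0, v))"
      using Suc.IH[of "\<lambda>z. frechet_derivative f (at z) (0, v)"] Suc.prems by simp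
    then show "Ck_on k {x. (a, x) \<in> W} (\<lambda>x. frechet_derivative (\<lambda>x. f (a, x)) (at x) v)"
      by (rule Ck_on_cong[OF op, rotated]) (rule eq)
  qed
qed

lemma smooth_on_slice:
  fixes f :: "'a::euclidean_space \<times> 'b::euclidean_space \<Rightarrow> 'c::euclidean_space"
  assumes "open W" "smooth_on W f"
  shows "smooth_on {x. (a, x) \<in> W} (\<lambda>x. f (a, x))"
  using assms Ck_on_slice unfolding smooth_on_def by blast

section \<open>Symmetry of second derivatives and the derivative of a tangent map\<close>

lemma second_difference_mvt:
  fixes f :: "'a::euclidean_space \<Rightarrow> real"
  assumes f: "\<And>z. z \<in> W \<Longrightarrow> (f has_derivative F z) (at z)"
    and F: "\<And>z. z \<in> W \<Longrightarrow> ((\<lambda>z. F z a) has_derivative F2 z) (at z)"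
    and h: "h > 0" and W: "\<And>s t. \<lbrakk>0 \<le> s; s \<le> h; 0 \<le> t; t \<le> h\<rbrakk> \<Longrightarrow> x + s *\<^sub>R a + t *\<^sub>R b \<in> W"
  obtains s t where "0 \<le> s" "s \<le> h" "0 \<le> t" "t \<le> h"
    "f (x + h *\<^sub>R a + h *\<^sub>R b) - f (x + h *\<^sub>R a) - f (x + h *\<^sub>R b) + f x
       = h * (h * F2 (x + s *\<^sub>R a + t *\<^sub>R b) b)"
proof -
  \<comment> \<open>The mean value theorem is used twice on the second difference: first in the
    direction \<open>a\<close> for \<open>g\<close>, then in the direction \<open>b\<close> for the
    derivative along \<open>a\<close>. Writing \<open>0 *\<^sub>R b\<close> makes both terms of
    \<open>g\<close> instances of \<open>dg\<close>, with \<open>t = h\<close> and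
    \<open>t = 0\<close>.\<close>
  define g where "g = (\<lambda>s. f (x + s *\<^sub>R a + h *\<^sub>R b) - f (x + s *\<^sub>R a + 0 *\<^sub>R b))"
  have dg: "((\<lambda>s. f (x + s *\<^sub>R a + t *\<^sub>R b)) has_derivative
      (\<lambda>r. r * F (x + s *\<^sub>R a + t *\<^sub>R b) a)) (at s)" if "0 \<le> s" "s \<le> h" "0 \<le> t" "t \<le> h" for s t
  proof -
    have "((\<lambda>s. x + s *\<^sub>R a + t *\<^sub>R b) has_derivative (\<lambda>r. r *\<^sub>R a)) (at s)"
      by (auto intro!: derivative_eq_intros)
    from has_derivative_compose[OF this f[OF W[OF that]]]
    show ?thesis
      using linear_cmul[OF has_derivative_linear[OF f[OF W[OF that]]]] by simp
  qed
  have "\<exists>s. 0 < s \<and> s < h \<and> g h - g 0 = (h - 0) * (F (x + s *\<^sub>R a + h *\<^sub>R b) a - F (x + s *\<^sub>R a + 0 *\<^sub>R b) a)"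
  proof (rule MVT2[OF h])
    fix s assume s: "0 \<le> s" "s \<le> h"
    have "(g has_derivative (\<lambda>r. r * F (x + s *\<^sub>R a + h *\<^sub>R b) a - r * F (x + s *\<^sub>R a + 0 *\<^sub>R b) a)) (at s)"
      unfolding g_def using h s by (intro has_derivative_diff dg) auto
    then show "(g has_real_derivative F (x + s *\<^sub>R a + h *\<^sub>R b) a - F (x + s *\<^sub>R a + 0 *\<^sub>R b) a) (at s)"
      unfolding has_field_derivative_def
      by (rule has_derivative_eq_rhs) (auto simp: algebra_simps)
  qed
  then obtain s where s: "0 < s" "s < h"
    and gs: "g h - g 0 = h * (F (x + s *\<^sub>R a + h *\<^sub>R b) a - F (x + s *\<^sub>R a + 0 *\<^sub>R b) a)" by auto
  have "\<exists>t. 0 < t \<and> t < h \<and> F (x + s *\<^sub>R a + h *\<^sub>R b) a - F (x + s *\<^sub>R a + 0 *\<^sub>R b) a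
      = (h - 0) * F2 (x + s *\<^sub>R a + t *\<^sub>R b) b"
  proof (rule MVT2[OF h])
    fix t assume t: "0 \<le> t" "t \<le> h"
    have m: "x + s *\<^sub>R a + t *\<^sub>R b \<in> W" using W[of s t] s t by simp
    have "((\<lambda>t. x + s *\<^sub>R a + t *\<^sub>R b) has_derivative (\<lambda>r. r *\<^sub>R b)) (at t)"
      by (auto intro!: derivative_eq_intros)
    from has_derivative_compose[OF this F[OF m]]
    show "((\<lambda>t. F (x + s *\<^sub>R a + t *\<^sub>R b) a) has_real_derivative F2 (x + s *\<^sub>R a + t *\<^sub>R b) b) (at t)"
      unfolding has_field_derivative_def using linear_cmul[OF has_derivative_linear[OF F[OF m]]]
      by (simp add: mult.commute[of _ "F2 _ b"])
  qed
  then obtain t where "0 < t" "t < h"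
    "F (x + s *\<^sub>R a + h *\<^sub>R b) a - F (x + s *\<^sub>R a + 0 *\<^sub>R b) a = h * F2 (x + s *\<^sub>R a + t *\<^sub>R b) b" by auto
  with gs s show thesis
    by (intro that[of s t]) (simp_all add: g_def)
qed

text \<open>The second difference does not change when \<open>a\<close> and \<open>b\<close> are
  exchanged. By the mean value lemma it is \<open>h * h\<close> times either mixed derivative at a
  point near \<open>x\<close>, and continuity carries the equality to \<open>x\<close>.\<close>

lemma second_derivative_symmetric_real:
  fixes f :: "'a::euclidean_space \<Rightarrow> real"
  assumes W: "open W" "x \<in> W"
    and f: "\<And>z. z \<in> W \<Longrightarrow> (f has_derivative F z) (at z)"
    and F: "\<And>z v. z \<in> W \<Longrightarrow> ((\<lambda>z. F z v) has_derivative F2 v z) (at z)"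
    and c: "\<And>v u. continuous_on W (\<lambda>z. F2 v z u)"
  shows "F2 a x b = F2 b x a"
proof (rule ccontr)
  assume "F2 a x b \<noteq> F2 b x a"
  \<comment> \<open>Half of the gap: two values that each move by less than this cannot
    meet.\<close>
  then have e: "\<bar>F2 a x b - F2 b x a\<bar> / 2 > 0" (is "?e > 0") by simp
  have "eventually (\<lambda>z. z \<in> W \<and> dist (F2 a z b) (F2 a x b) < ?e \<and> dist (F2 b z a) (F2 b x a) < ?e) (at x)"
    using W c e unfolding continuous_on_eq_continuous_at[OF W(1)] continuous_at
    by (intro eventually_conj eventually_at_in_open' tendstoD) auto
  then obtain d where d: "d > 0"
    and near: "\<And>z. dist z x < d \<Longrightarrow> z \<in> W \<and> dist (F2 a z b) (F2 a x b) < ?e \<and> dist (F2 b z a) (F2 b x a) < ?e"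
    using W e unfolding eventually_at
    by (smt (verit, del_insts) dist_self mem_Collect_eq UNIV_I)
  \<comment> \<open>Small enough for the whole parallelogram of steps up to \<open>h\<close> along
    \<open>a\<close> and \<open>b\<close> to stay within \<open>d\<close> of \<open>x\<close>. The
    added 1 keeps the denominator positive when both directions vanish, and the factor 2 leaves room
    for a strict inequality.\<close>
  define h where "h = d / (2 * (norm a + norm b + 1))"
  have pos: "norm a + norm b + 1 > 0" by (smt (verit) norm_ge_zero)
  have h: "h > 0" unfolding h_def using d pos by simp
  have box: "dist (x + s *\<^sub>R u + t *\<^sub>R v) x < d"
    if "0 \<le> s" "s \<le> h" "0 \<le> t" "t \<le> h" "u = a \<and> v = b \<or> u = b \<and> v = a" for s t u v
  proof -
    have "dist (x + s *\<^sub>R u + t *\<^sub>R v) x \<le> s * norm u + t * norm v"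
      using norm_triangle_ineq[of "s *\<^sub>R u" "t *\<^sub>R v"] that by (simp add: dist_norm add.assoc)
    also have "\<dots> \<le> h * norm u + h * norm v"
      using that by (intro add_mono mult_right_mono) auto
    also have "\<dots> = h * (norm a + norm b)" using that(5) by (auto simp: algebra_simps)
    also have "\<dots> < h * (2 * (norm a + norm b + 1))" using h by (intro mult_strict_left_mono) (auto simp: add_nonneg_pos add_pos_nonneg)
    also have "\<dots> = d" unfolding h_def using pos by simp
    finally show ?thesis .
  qed
  obtain s t where st: "0 \<le> s" "s \<le> h" "0 \<le> t" "t \<le> h"
    "f (x + h *\<^sub>R a + h *\<^sub>R b) - f (x + h *\<^sub>R a) - f (x + h *\<^sub>R b) + f x
       = h * (h * F2 a (x + s *\<^sub>R a + t *\<^sub>R b) b)"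
    by (rule second_difference_mvt[of W f F a "F2 a" h x b]) (use f F h near box in auto)
  obtain s' t' where st': "0 \<le> s'" "s' \<le> h" "0 \<le> t'" "t' \<le> h"
    "f (x + h *\<^sub>R b + h *\<^sub>R a) - f (x + h *\<^sub>R b) - f (x + h *\<^sub>R a) + f x
       = h * (h * F2 b (x + s' *\<^sub>R b + t' *\<^sub>R a) a)"
    by (rule second_difference_mvt[of W f F b "F2 b" h x a]) (use f F h near box in auto)
  have sw: "x + h *\<^sub>R b + h *\<^sub>R a = x + h *\<^sub>R a + h *\<^sub>R b" by simp
  have "h * (h * F2 a (x + s *\<^sub>R a + t *\<^sub>R b) b) = h * (h * F2 b (x + s' *\<^sub>R b + t' *\<^sub>R a) a)"
    using st(5) st'(5) unfolding sw by linarith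
  then have "F2 a (x + s *\<^sub>R a + t *\<^sub>R b) b = F2 b (x + s' *\<^sub>R b + t' *\<^sub>R a) a"
    using h by simp
  moreover have "\<bar>F2 a (x + s *\<^sub>R a + t *\<^sub>R b) b - F2 a x b\<bar> < ?e"
    using near[OF box[of s t a b]] st by (auto simp: dist_real_def)
  moreover have "\<bar>F2 b (x + s' *\<^sub>R b + t' *\<^sub>R a) a - F2 b x a\<bar> < ?e"
    using near[OF box[of s' t' b a]] st' by (auto simp: dist_real_def)
  ultimately show False by argo
qed

lemma smooth_on_second_derivative_symmetric:
  fixes f :: "'a::euclidean_space \<Rightarrow> 'b::euclidean_space"
  assumes "open W" "smooth_on W f" "x \<in> W"
  shows "frechet_derivative (\<lambda>z. frechet_derivative f (at z) a) (at x) b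
       = frechet_derivative (\<lambda>z. frechet_derivative f (at z) b) (at x) a"
proof (rule euclidean_eqI)
  fix i :: 'b assume "i \<in> Basis"
  show "frechet_derivative (\<lambda>z. frechet_derivative f (at z) a) (at x) b \<bullet> i
      = frechet_derivative (\<lambda>z. frechet_derivative f (at z) b) (at x) a \<bullet> i"
  proof (rule second_derivative_symmetric_real[OF assms(1,3)])
    show "((\<lambda>z. f z \<bullet> i) has_derivative (\<lambda>v. frechet_derivative f (at z) v \<bullet> i)) (at z)" if "z \<in> W" for z
      using smooth_on_has_derivative[OF assms(2) that] by (rule has_derivative_inner_left)
    show "((\<lambda>z. frechet_derivative f (at z) v \<bullet> i) has_derivative
        (\<lambda>u. frechet_derivative (\<lambda>z. frechet_derivative f (at z) v) (at z) u \<bullet> i)) (at z)"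
      if "z \<in> W" for z v
      using smooth_on_has_derivative[OF smooth_on_derivative[OF assms(2)] that]
      by (rule has_derivative_inner_left)
    show "continuous_on W (\<lambda>z. frechet_derivative (\<lambda>z. frechet_derivative f (at z) v) (at z) u \<bullet> i)"
      for v u
      by (intro continuous_on_inner continuous_on_const smooth_on_continuous_on
          smooth_on_derivative assms(2))
  qed
qed

text \<open>Linearity in \<open>y\<close> makes the map a finite sum of products of
  \<open>y \<bullet> j\<close> with functions of \<open>x\<close> alone, so joint differentiability
  reduces to the product rule. The map is the fibre part of a coordinate change of the tangent
  bundle.\<close>

lemma smooth_on_tangent_has_derivative:
  fixes f :: "'a::euclidean_space \<Rightarrow> 'b::euclidean_space"
  assumes W: "open W" and f: "smooth_on W f" and x: "x \<in> W"
  shows "((\<lambda>(x, y). frechet_derivative f (at x) y) has_derivative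
     (\<lambda>(a, b). frechet_derivative (\<lambda>z. frechet_derivative f (at z) y) (at x) a
        + frechet_derivative f (at x) b)) (at (x, y))"
proof -
  have exp: "frechet_derivative f (at z) v = (\<Sum>j\<in>Basis. (v \<bullet> j) *\<^sub>R frechet_derivative f (at z) j)"
    if "z \<in> W" for z v
  proof -
    have "frechet_derivative f (at z) v = frechet_derivative f (at z) (\<Sum>j\<in>Basis. (v \<bullet> j) *\<^sub>R j)"
      by (simp add: euclidean_representation)
    then show ?thesis
      using smooth_on_linear_derivative[OF f that] by (simp add: linear_sum linear_cmul)
  qed
  define E where "E = (\<lambda>z::'a\<times>'a. \<Sum>j\<in>Basis. (snd z \<bullet> j) *\<^sub>R frechet_derivative f (at (fst z)) j)"
  have d: "((\<lambda>z::'a\<times>'a. frechet_derivative f (at (fst z)) j) has_derivative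
      (\<lambda>h. frechet_derivative (\<lambda>z. frechet_derivative f (at z) j) (at x) (fst h))) (at (x, y))" for j
    using has_derivative_compose[OF has_derivative_fst[OF has_derivative_ident, of "at (x, y)"],
        of "\<lambda>z. frechet_derivative f (at z) j"]
      smooth_on_has_derivative[OF smooth_on_derivative[OF f] x] by simp
  define E' where "E' = (\<lambda>h::'a\<times>'a. \<Sum>j\<in>Basis.
      (y \<bullet> j) *\<^sub>R frechet_derivative (\<lambda>z. frechet_derivative f (at z) j) (at x) (fst h)
       + (snd h \<bullet> j) *\<^sub>R frechet_derivative f (at x) j)"
  have E: "(E has_derivative E') (at (x, y))"
    unfolding E_def E'_def
    by (rule has_derivative_sum, rule has_derivative_eq_rhs,
       rule has_derivative_scaleR, rule has_derivative_inner_left,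
       rule has_derivative_snd[OF has_derivative_ident], rule d, simp)
  have "((\<lambda>z. \<Sum>j\<in>Basis. (y \<bullet> j) *\<^sub>R frechet_derivative f (at z) j) has_derivative
      (\<lambda>a. \<Sum>j\<in>Basis. (y \<bullet> j) *\<^sub>R frechet_derivative (\<lambda>z. frechet_derivative f (at z) j) (at x) a)) (at x)"
    by (intro has_derivative_sum has_derivative_scaleR_right
        smooth_on_has_derivative[OF smooth_on_derivative[OF f] x])
  then have D: "((\<lambda>z. frechet_derivative f (at z) y) has_derivative
      (\<lambda>a. \<Sum>j\<in>Basis. (y \<bullet> j) *\<^sub>R frechet_derivative (\<lambda>z. frechet_derivative f (at z) j) (at x) a)) (at x)"
    by (rule has_derivative_transform_within_open[OF _ W x]) (simp add: exp)
  \<comment> \<open>The sum produced by the product rule is the derivative of a single function, the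
    directional derivative of \<open>f\<close> along the fixed \<open>y\<close>.\<close>
  then have D2: "frechet_derivative (\<lambda>z. frechet_derivative f (at z) y) (at x) a
      = (\<Sum>j\<in>Basis. (y \<bullet> j) *\<^sub>R frechet_derivative (\<lambda>z. frechet_derivative f (at z) j) (at x) a)" for a
    using fun_cong[OF frechet_derivative_at[OF D], of a] by simp
  have "E' = (\<lambda>(a, b). frechet_derivative (\<lambda>z. frechet_derivative f (at z) y) (at x) a
        + frechet_derivative f (at x) b)"
  proof (rule ext, clarify)
    fix a b
    show "E' (a, b) = frechet_derivative (\<lambda>z. frechet_derivative f (at z) y) (at x) a
        + frechet_derivative f (at x) b"
      unfolding exp[OF x, of b] by (simp add: E'_def D2 sum.distrib)
  qed
  with E have "(E has_derivative (\<lambda>(a, b). frechet_derivative (\<lambda>z. frechet_derivative f (at z) y) (at x) a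
        + frechet_derivative f (at x) b)) (at (x, y))" by simp
  then show ?thesis
    by (rule has_derivative_transform_within_open[OF _ open_Times[OF W open_UNIV]])
      (use x in \<open>auto simp: E_def exp[symmetric]\<close>)
qed

text \<open>The solution is differentiable by Cramer's rule.\<close>

lemma linear_system_has_vector_derivative:
  fixes M :: "real \<Rightarrow> real^'n^'n" and v Y :: "real \<Rightarrow> real^'n"
  assumes M: "\<And>i j. ((\<lambda>s. M s $ i $ j) has_real_derivative M' $ i $ j) (at t)"
    and Mt: "M t = mat 1" and I: "open I" "t \<in> I" and Mv: "\<And>s. s \<in> I \<Longrightarrow> Y s = M s *v v s"
    and Y: "(Y has_vector_derivative Y') (at t)"
  shows "(v has_vector_derivative Y' - M' *v v t) (at t)"
proof -
  have Yi: "((\<lambda>s. Y s $ i) has_real_derivative Y' $ i) (at t)" for i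
    using bounded_linear.has_vector_derivative[OF bounded_linear_vec_nth Y]
    by (simp add: has_real_derivative_iff_has_vector_derivative)
  have Md: "(\<lambda>s. M s $ i $ j) differentiable (at t)" for i j
    using M real_differentiable_def by blast
  have Yd: "(\<lambda>s. Y s $ i) differentiable (at t)" for i
    using Yi real_differentiable_def by blast
  have det_diff: "(\<lambda>s. det (B s)) differentiable (at t)"
    if B: "\<And>i j. (\<lambda>s. B s $ i $ j) differentiable (at t)" for B :: "real \<Rightarrow> real^'n^'n"
  proof -
    have pr: "(\<lambda>s. \<Prod>i\<in>J. B s $ i $ p i) differentiable (at t)" if "finite J" for J p
      using that
    proof induction
      case (insert i J)
      then show ?case
        using differentiable_mult[OF B[of i "p i"] insert.IH] by simp
    qed simp
    show ?thesis
      unfolding det_def by (intro differentiable_sum ballI differentiable_mult pr) auto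
  qed
  \<comment> \<open>The determinant is 1 at \<open>t\<close>, hence nonzero nearby. The
    neighbourhood obtained this way is punctured; \<open>J0\<close> puts \<open>t\<close>
    back.\<close>
  have "continuous (at t) (\<lambda>s. det (M s))"
    by (rule differentiable_imp_continuous_within[OF det_diff[OF Md]])
  then have "eventually (\<lambda>s. det (M s) \<noteq> 0) (at t)"
    unfolding continuous_at by (intro tendsto_imp_eventually_ne[of _ "det (M t)"]) (auto simp: Mt)
  then obtain J where J: "open J" "t \<in> J" "\<And>s. s \<in> J \<Longrightarrow> s \<noteq> t \<Longrightarrow> det (M s) \<noteq> 0"
    unfolding eventually_at_topological by auto
  have J0: "det (M s) \<noteq> 0" if "s \<in> J" for s
    using J(3)[OF that] Mt by (cases "s = t") auto
  \<comment> \<open>The numerator in Cramer's rule: column \<open>k\<close> of \<open>M s\<close> is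
    replaced by \<open>Y s\<close>. Its determinant is a polynomial in differentiable
    entries.\<close>
  define C where "C = (\<lambda>k s. (\<chi> i j. if j = k then Y s $ i else M s $ i $ j) :: real^'n^'n)"
  have vk: "det (C k s) / det (M s) = v s $ k" if "s \<in> I \<inter> J" for s k
    using cramer[OF J0, of s "v s" "Y s"] Mv that by (simp add: C_def)
  have vd: "(\<lambda>s. v s $ k) differentiable (at t)" for k
  proof -
    have "(\<lambda>s. det (C k s)) differentiable (at t)"
    proof (rule det_diff)
      show "(\<lambda>s. C k s $ i $ j) differentiable (at t)" for i j
        using Md Yd by (cases "j = k") (simp_all add: C_def)
    qed
    then have "(\<lambda>s. det (C k s) / det (M s)) differentiable (at t)"
      using det_diff[OF Md] J0[OF J(2)] by (rule differentiable_divide)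
    then show ?thesis
      unfolding differentiable_def using has_derivative_transform_within_open[of _ _ t UNIV "I \<inter> J"]
      by (metis (no_types, lifting) I J(1,2) IntI open_Int vk)
  qed
  define v' where "v' = (\<chi> k. deriv (\<lambda>s. v s $ k) t)"
  have vi: "((\<lambda>s. v s $ k) has_real_derivative v' $ k) (at t)" for k
    using vd[of k] unfolding v'_def by (simp add: DERIV_deriv_iff_real_differentiable)
  \<comment> \<open>Product rule for \<open>Y = M v\<close>. As \<open>M t\<close> is the identity
    matrix, the term containing the derivative of \<open>v\<close> is that derivative
    itself.\<close>
  have Y'i: "Y' $ i = (M' *v v t) $ i + v' $ i" for i
  proof -
    have "((\<lambda>s. \<Sum>j\<in>UNIV. M s $ i $ j * v s $ j) has_real_derivative
        (\<Sum>j\<in>UNIV. M' $ i $ j * v t $ j + v' $ j * M t $ i $ j)) (at t)"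
      by (intro DERIV_sum DERIV_mult M vi)
    moreover have "(\<Sum>j\<in>UNIV. M' $ i $ j * v t $ j + v' $ j * M t $ i $ j) = (M' *v v t) $ i + v' $ i"
      by (simp add: sum.distrib matrix_vector_mult_def Mt mat_def if_distrib[of "(*) _"] cong: if_cong)
    ultimately have "((\<lambda>s. Y s $ i) has_real_derivative (M' *v v t) $ i + v' $ i) (at t)"
      using has_field_derivative_transform_within_open[OF _ I, of _ _ "\<lambda>s. Y s $ i"]
      by (simp add: Mv matrix_vector_mult_def)
    then show ?thesis using Yi DERIV_unique by blast
  qed
  then have "Y' - M' *v v t = v'" by (simp add: vec_eq_iff)
  moreover have "(v has_vector_derivative v') (at t)"
    unfolding has_vector_derivative_def
    by (subst has_derivative_componentwise_within)
      (use vi in \<open>auto simp: Basis_vec_def inner_axis has_field_derivative_def mult.commute[of _ "v' $ _"]\<close>)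
  ultimately show ?thesis by simp
qed

section \<open>Charts and tangent vectors\<close>

text \<open>Both functions have exactly the same derivatives at \<open>x\<close>, so the choice
  operator behind \<open>frechet_derivative\<close> selects the same map, whether or not a
  derivative exists.\<close>

lemma frechet_derivative_cong_open:
  assumes "open W" "x \<in> W" "\<And>z. z \<in> W \<Longrightarrow> f z = g z"
  shows "frechet_derivative f (at x) = frechet_derivative g (at x)"
proof -
  have "(f has_derivative D) (at x) \<longleftrightarrow> (g has_derivative D) (at x)" for D
    using has_derivative_transform_within_open[OF _ assms(1,2), of _ D UNIV] assms(3) by metis
  then show ?thesis
    unfolding frechet_derivative_def by simp
qed

lemma charts_atD:
  assumes "c \<in> charts_at A p"
  shows "c \<in> A" "p \<in> fst c"
  using assms by (auto simp: charts_at_def)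

lemma charts_at_nonempty:
  assumes "p \<in> points A"
  shows "\<exists>c. c \<in> charts_at A p"
  using assms by (auto simp: points_def charts_at_def)

lemma chart_inv_chart [simp]:
  assumes "is_chart c" "p \<in> fst c"
  shows "chart_inv c (snd c p) = p"
  using assms by (simp add: chart_inv_def is_chart_def)

lemma chart_inv_image:
  assumes "x \<in> snd c ` P" "is_chart c" "P \<subseteq> fst c"
  shows "chart_inv c x \<in> P" "snd c (chart_inv c x) = x"
  using assms by auto

lemma tangent_space_subspace:
  assumes "smooth_atlas A"
  shows "0 \<in> tangent_space A p"
    and "\<lbrakk>\<xi> \<in> tangent_space A p; \<zeta> \<in> tangent_space A p\<rbrakk> \<Longrightarrow> \<xi> + \<zeta> \<in> tangent_space A p"
    and "\<xi> \<in> tangent_space A p \<Longrightarrow> r *\<^sub>R \<xi> \<in> tangent_space A p"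
proof -
  have lin: "linear (frechet_derivative (snd d \<circ> chart_inv c) (at (snd c p)))"
    if "c \<in> charts_at A p" "d \<in> charts_at A p" for c d
    by (rule smooth_on_linear_derivative[of "snd c ` (fst c \<inter> fst d)"])
      (use assms that in \<open>auto simp: smooth_atlas_def compatible_def smooth_transition_def charts_at_def\<close>)
  show "0 \<in> tangent_space A p"
    unfolding tangent_space_def using lin by (auto simp: linear_0)
  show "\<xi> + \<zeta> \<in> tangent_space A p" if m: "\<xi> \<in> tangent_space A p" "\<zeta> \<in> tangent_space A p"
    unfolding tangent_space_def
  proof (intro CollectI conjI allI impI ballI)
    fix c d assume cd: "c \<in> charts_at A p" "d \<in> charts_at A p"
    have "\<xi> d = frechet_derivative (snd d \<circ> chart_inv c) (at (snd c p)) (\<xi> c)"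
      "\<zeta> d = frechet_derivative (snd d \<circ> chart_inv c) (at (snd c p)) (\<zeta> c)"
      using m cd unfolding tangent_space_def by blast+
    then show "(\<xi> + \<zeta>) d = frechet_derivative (snd d \<circ> chart_inv c) (at (snd c p)) ((\<xi> + \<zeta>) c)"
      using lin[OF cd] by (simp add: linear_add)
  next
    fix c assume "c \<notin> charts_at A p"
    then have "\<xi> c = 0" "\<zeta> c = 0" using m unfolding tangent_space_def by blast+
    then show "(\<xi> + \<zeta>) c = 0" by simp
  qed
  show "r *\<^sub>R \<xi> \<in> tangent_space A p" if m: "\<xi> \<in> tangent_space A p"
    unfolding tangent_space_def
  proof (intro CollectI conjI allI impI ballI)
    fix c d assume cd: "c \<in> charts_at A p" "d \<in> charts_at A p"
    have "\<xi> d = frechet_derivative (snd d \<circ> chart_inv c) (at (snd c p)) (\<xi> c)"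
      using m cd unfolding tangent_space_def by blast
    then show "(r *\<^sub>R \<xi>) d = frechet_derivative (snd d \<circ> chart_inv c) (at (snd c p)) ((r *\<^sub>R \<xi>) c)"
      using lin[OF cd] by (simp add: linear_cmul scaleR_fun_def)
  next
    fix c assume "c \<notin> charts_at A p"
    then have "\<xi> c = 0" using m unfolding tangent_space_def by blast
    then show "(r *\<^sub>R \<xi>) c = 0" by (simp add: scaleR_fun_def)
  qed
qed

lemma tangent_space_sum:
  assumes "smooth_atlas A" "\<And>i. i \<in> J \<Longrightarrow> \<xi> i \<in> tangent_space A p"
  shows "(\<Sum>i\<in>J. \<xi> i) \<in> tangent_space A p"
  using assms(2)
  by (induction J rule: infinite_finite_induct) (auto intro: tangent_space_subspace[OF assms(1)])

lemma tvec_sum_apply: "(\<Sum>i\<in>J. \<xi> i) c = (\<Sum>i\<in>J. \<xi> i c :: 'e::real_vector)"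
  by (induction J rule: infinite_finite_induct) auto

locale atlas =
  fixes A :: "('a, 'e::euclidean_space) chart set"
  assumes smooth: "smooth_atlas A"
begin

lemma is_chart: "c \<in> A \<Longrightarrow> is_chart c"
  using smooth by (auto simp: smooth_atlas_def)

lemma is_chart_at: "c \<in> charts_at A p \<Longrightarrow> is_chart c"
  by (rule is_chart[OF charts_atD(1)])

lemma transition:
  assumes "c \<in> A" "d \<in> A"
  shows "open (snd c ` (fst c \<inter> fst d))" "smooth_on (snd c ` (fst c \<inter> fst d)) (snd d \<circ> chart_inv c)"
  using assms smooth by (auto simp: smooth_atlas_def compatible_def smooth_transition_def)

text \<open>Makes a change of charts the special case of the identity map in the chain rule
  below.\<close>

lemma smooth_map_ident: "smooth_map A A (\<lambda>p. p)"
  unfolding smooth_map_def using transition by (auto simp: comp_def)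

lemma in_transition_domain:
  assumes "c \<in> charts_at A p" "d \<in> charts_at A p"
  shows "snd c p \<in> snd c ` (fst c \<inter> fst d)"
  using assms by (auto simp: charts_at_def)

end

lemma smooth_map_in_charts:
  assumes "smooth_map A B f" "c \<in> charts_at A p" "d \<in> charts_at B (f p)"
  shows "open (snd c ` (fst c \<inter> f -` fst d))" "snd c p \<in> snd c ` (fst c \<inter> f -` fst d)"
    "smooth_on (snd c ` (fst c \<inter> f -` fst d)) (snd d \<circ> f \<circ> chart_inv c)"
  using assms unfolding smooth_map_def charts_at_def by auto

text \<open>Near \<open>snd c p\<close> the composite factors through the chart \<open>d\<close>.
  The outer function \<open>h\<close> is left general: it will be a chart map, or a chart map after
  a left translation.\<close>

lemma chain_rule_in_charts:
  assumes "smooth_atlas A" "smooth_atlas B" and f: "smooth_map A B f"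
    and c: "c \<in> charts_at A p" and d: "d \<in> charts_at B (f p)"
    and h: "(h \<circ> chart_inv d) differentiable (at (snd d (f p)))"
  shows "((h \<circ> f \<circ> chart_inv c) has_derivative
     (\<lambda>v. frechet_derivative (h \<circ> chart_inv d) (at (snd d (f p)))
        (frechet_derivative (snd d \<circ> f \<circ> chart_inv c) (at (snd c p)) v))) (at (snd c p))"
proof -
  interpret A: atlas A by unfold_locales fact
  interpret B: atlas B by unfold_locales fact
  note W = smooth_map_in_charts[OF f c d]
  have "chart_inv c (snd c p) = p" using A.is_chart_at[OF c] charts_atD[OF c] by simp
  then have "((\<lambda>x. (h \<circ> chart_inv d) ((snd d \<circ> f \<circ> chart_inv c) x)) has_derivative
     (\<lambda>v. frechet_derivative (h \<circ> chart_inv d) (at (snd d (f p)))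
        (frechet_derivative (snd d \<circ> f \<circ> chart_inv c) (at (snd c p)) v))) (at (snd c p))"
    using has_derivative_compose[OF smooth_on_has_derivative[OF W(3,2)], of "h \<circ> chart_inv d"] h
    by (simp add: frechet_derivative_works)
  then show ?thesis
    by (rule has_derivative_transform_within_open[OF _ W(1,2)])
      (use A.is_chart_at[OF c] B.is_chart_at[OF d] in auto)
qed

section \<open>Tangent vectors determined by one component, and pushforwards\<close>

context atlas
begin

text \<open>The inverse of evaluation at \<open>c\<close> on \<open>tangent_space A p\<close>, by
  \<open>tvec_of_self\<close> and \<open>tvec_of_component\<close>. It identifies the tangent space
  with the model space, so that functions of tangent vectors can be differentiated there.\<close>

definition tvec_of :: "'a \<Rightarrow> ('a, 'e) chart \<Rightarrow> 'e \<Rightarrow> ('a, 'e) tvec"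
  where "tvec_of p c v = (\<lambda>d. if d \<in> charts_at A p
    then frechet_derivative (snd d \<circ> chart_inv c) (at (snd c p)) v else 0)"

lemma transition_at:
  assumes "c \<in> charts_at A p" "d \<in> charts_at A p"
  shows "open (snd c ` (fst c \<inter> fst d))"
    "smooth_on (snd c ` (fst c \<inter> fst d)) (snd d \<circ> chart_inv c)"
    "snd c p \<in> snd c ` (fst c \<inter> fst d)"
  by (rule transition in_transition_domain charts_atD(1)[OF assms(1)] charts_atD(1)[OF assms(2)] assms)+

lemma change_of_chart:
  assumes c: "c \<in> charts_at A p" and d: "d \<in> charts_at A p"
    and h: "(h \<circ> chart_inv d) differentiable (at (snd d p))"
  shows "((h \<circ> chart_inv c) has_derivative
     (\<lambda>v. frechet_derivative (h \<circ> chart_inv d) (at (snd d p))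
        (frechet_derivative (snd d \<circ> chart_inv c) (at (snd c p)) v))) (at (snd c p))"
  using chain_rule_in_charts[OF smooth smooth smooth_map_ident c d h] by (simp add: comp_def)

lemma transition_differentiable:
  assumes c: "c \<in> charts_at A p" and d: "d \<in> charts_at A p"
  shows "(snd d \<circ> chart_inv c) differentiable (at (snd c p))"
  by (rule smooth_on_differentiable[OF transition_at(2,3)[OF c d]])

lemma transition_cocycle:
  assumes "c \<in> charts_at A p" "d \<in> charts_at A p" "b \<in> charts_at A p"
  shows "frechet_derivative (snd b \<circ> chart_inv c) (at (snd c p)) v =
    frechet_derivative (snd b \<circ> chart_inv d) (at (snd d p))
      (frechet_derivative (snd d \<circ> chart_inv c) (at (snd c p)) v)"
  by (rule fun_cong[OF frechet_derivative_at[symmetric]],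
    rule change_of_chart[OF assms(1,2) transition_differentiable[OF assms(2,3)]])

lemma transition_self:
  assumes "c \<in> charts_at A p"
  shows "frechet_derivative (snd c \<circ> chart_inv c) (at (snd c p)) v = v"
proof -
  have "frechet_derivative (snd c \<circ> chart_inv c) (at (snd c p)) = frechet_derivative (\<lambda>x. x) (at (snd c p))"
    by (rule frechet_derivative_cong_open[OF transition(1)[of c c]])
      (use assms is_chart_at[OF assms] in \<open>auto simp: charts_at_def\<close>)
  then show ?thesis by simp
qed

lemma transition_linear:
  assumes "c \<in> charts_at A p" "d \<in> charts_at A p"
  shows "linear (frechet_derivative (snd d \<circ> chart_inv c) (at (snd c p)))"
  by (rule linear_frechet_derivative[OF transition_differentiable[OF assms]])

lemma tvec_of_in_tangent_space:
  assumes "c \<in> charts_at A p"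
  shows "tvec_of p c v \<in> tangent_space A p"
  unfolding tangent_space_def
proof (intro CollectI conjI allI impI ballI)
  fix b d assume "b \<in> charts_at A p" "d \<in> charts_at A p"
  then show "tvec_of p c v d = frechet_derivative (snd d \<circ> chart_inv b) (at (snd b p)) (tvec_of p c v b)"
    using transition_cocycle[OF assms, of b d v] by (simp add: tvec_of_def)
qed (simp add: tvec_of_def)

lemma tvec_of_self [simp]:
  assumes "c \<in> charts_at A p"
  shows "tvec_of p c v c = v"
  using assms by (simp add: tvec_of_def transition_self)

lemma tangent_spaceD:
  assumes "\<xi> \<in> tangent_space A p"
  shows "c \<notin> charts_at A p \<Longrightarrow> \<xi> c = 0"
    "\<lbrakk>c \<in> charts_at A p; d \<in> charts_at A p\<rbrakk> \<Longrightarrow>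
      \<xi> d = frechet_derivative (snd d \<circ> chart_inv c) (at (snd c p)) (\<xi> c)"
  using assms unfolding tangent_space_def by blast+

lemma tvec_of_component:
  assumes "\<xi> \<in> tangent_space A p" "c \<in> charts_at A p"
  shows "tvec_of p c (\<xi> c) = \<xi>"
proof
  fix d
  show "tvec_of p c (\<xi> c) d = \<xi> d"
  proof (cases "d \<in> charts_at A p")
    case True
    then show ?thesis
      unfolding tvec_of_def by (simp only: if_True tangent_spaceD(2)[OF assms True])
  next
    case False
    then show ?thesis
      by (simp add: tvec_of_def tangent_spaceD(1)[OF assms(1)])
  qed
qed

lemma tangent_space_eqI:
  assumes "\<xi> \<in> tangent_space A p" "\<zeta> \<in> tangent_space A p" "c \<in> charts_at A p" "\<xi> c = \<zeta> c"
  shows "\<xi> = \<zeta>"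
  using tvec_of_component assms by metis

lemma component_eq_0_iff:
  assumes "\<xi> \<in> tangent_space A p" "c \<in> charts_at A p"
  shows "\<xi> c = 0 \<longleftrightarrow> \<xi> = 0"
  using tangent_space_eqI[OF assms(1) tangent_space_subspace(1)[OF smooth] assms(2)] by auto

lemma tvec_of_linear:
  assumes "c \<in> charts_at A p"
  shows "tvec_of p c (u + v) = tvec_of p c u + tvec_of p c v"
    "tvec_of p c (r *\<^sub>R v) = r *\<^sub>R tvec_of p c v"
  using transition_linear[OF assms]
  by (auto simp: tvec_of_def fun_eq_iff linear_add linear_cmul scaleR_fun_def)

end

text \<open>Replaces the chart selected by \<open>SOME\<close> in \<open>pushforward\<close> by an
  arbitrary \<open>c\<close>. The coordinate change between the two charts is absorbed by the
  transformation law of \<open>\<xi>\<close>.\<close>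

lemma pushforward_component:
  assumes A: "smooth_atlas A" and B: "smooth_atlas B" and f: "smooth_map A B f"
    and c: "c \<in> charts_at A p" and d: "d \<in> charts_at B (f p)" and \<xi>: "\<xi> \<in> tangent_space A p"
  shows "pushforward A B f p \<xi> d = frechet_derivative (snd d \<circ> f \<circ> chart_inv c) (at (snd c p)) (\<xi> c)"
proof -
  interpret A: atlas A by unfold_locales fact
  define b where "b = (SOME c. c \<in> charts_at A p)"
  have b: "b \<in> charts_at A p"
    unfolding b_def using someI[of "\<lambda>c. c \<in> charts_at A p", OF c] .
  have "(snd d \<circ> f \<circ> chart_inv b) differentiable (at (snd b p))"
    using smooth_on_differentiable[OF smooth_map_in_charts(3,2)[OF f b d]] .
  from fun_cong[OF frechet_derivative_at[OF A.change_of_chart[OF c b this]], of "\<xi> c"]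
  have "frechet_derivative (snd d \<circ> f \<circ> chart_inv c) (at (snd c p)) (\<xi> c)
     = frechet_derivative (snd d \<circ> f \<circ> chart_inv b) (at (snd b p)) (\<xi> b)"
    unfolding A.tangent_spaceD(2)[OF \<xi> c b] by (rule sym)
  then show ?thesis
    using d by (simp add: pushforward_def b_def Let_def)
qed

lemma pushforward_in_tangent_space:
  assumes A: "smooth_atlas A" and B: "smooth_atlas B" and f: "smooth_map A B f"
    and p: "p \<in> points A" and \<xi>: "\<xi> \<in> tangent_space A p"
  shows "pushforward A B f p \<xi> \<in> tangent_space B (f p)"
proof -
  interpret B: atlas B by unfold_locales fact
  obtain c where c: "c \<in> charts_at A p" using charts_at_nonempty[OF p] ..
  have e: "pushforward A B f p \<xi> d' = frechet_derivative (snd d' \<circ> chart_inv d) (at (snd d (f p)))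
      (pushforward A B f p \<xi> d)"
    if d: "d \<in> charts_at B (f p)" and d': "d' \<in> charts_at B (f p)" for d d'
  proof -
    note D = B.transition_differentiable[OF d d']
    from frechet_derivative_at[OF chain_rule_in_charts[OF A B f c d D]]
    show ?thesis
      unfolding pushforward_component[OF A B f c d \<xi>] pushforward_component[OF A B f c d' \<xi>] by (rule fun_cong[OF sym])
  qed
  show ?thesis
    unfolding tangent_space_def
    by (intro CollectI conjI ballI allI impI, simp add: pushforward_def, rule e)
qed

section \<open>The slit tangent bundle\<close>

text \<open>Needed because \<open>complete_lift\<close> recovers the base chart through
  \<open>the_inv_into\<close>.\<close>

lemma slit_chart_inject:
  fixes A :: "('a, 'e::euclidean_space) chart set"
  assumes "slit_chart A c = slit_chart A d"
  shows "c = d"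
proof -
  have e: "(snd c p, \<xi> c) = (snd d p, \<xi> d)" for p and \<xi> :: "('a, 'e) tvec"
    using fun_cong[OF arg_cong[OF assms, of snd], of "(p, \<xi>)"] by (simp add: slit_chart_def)
  obtain b :: 'e where "b \<noteq> 0" using nonzero_Basis nonempty_Basis by blast
  \<comment> \<open>A family supported at \<open>c\<close> alone tells \<open>c\<close> from
    \<open>d\<close>. The equation \<open>e\<close> holds for every family, tangent or not, because
    the coordinate map of \<open>slit_chart\<close> is a total function.\<close>
  moreover have "(if c = c then b else 0) = (if d = c then b else 0)"
    using e[of undefined "\<lambda>k. if k = c then b else 0"] by blast
  ultimately show "c = d" by (auto split: if_splits)
qed

lemma snd_slit_chart [simp]: "snd (slit_chart A c) (p, \<xi>) = (snd c p, \<xi> c)"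
  by (simp add: slit_chart_def)

lemma fst_slit_chart:
  "(p, \<xi>) \<in> fst (slit_chart A c) \<longleftrightarrow> p \<in> fst c \<and> \<xi> \<in> tangent_space A p \<and> \<xi> \<noteq> 0"
  by (simp add: slit_chart_def)

lemma charts_at_slit_atlas:
  assumes "\<xi> \<in> tangent_space A p" "\<xi> \<noteq> 0"
  shows "charts_at (slit_atlas A) (p, \<xi>) = slit_chart A ` charts_at A p"
  using assms by (auto simp: charts_at_def slit_atlas_def fst_slit_chart)

context atlas
begin

lemma chart_inv_slit_chart:
  assumes c: "c \<in> A" and x: "x \<in> snd c ` fst c" and y: "y \<noteq> 0"
  shows "chart_inv (slit_chart A c) (x, y) = (chart_inv c x, tvec_of (chart_inv c x) c y)"
    "(chart_inv c x, tvec_of (chart_inv c x) c y) \<in> fst (slit_chart A c)"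
proof -
  have ci: "chart_inv c x \<in> fst c" "snd c (chart_inv c x) = x"
    using chart_inv_image[OF x is_chart[OF c]] by auto
  then have ca: "c \<in> charts_at A (chart_inv c x)" using c by (simp add: charts_at_def)
  have inj: "inj_on (snd (slit_chart A c)) (fst (slit_chart A c))"
  proof (rule inj_onI)
    fix v w assume v: "v \<in> fst (slit_chart A c)" "w \<in> fst (slit_chart A c)"
      and e: "snd (slit_chart A c) v = snd (slit_chart A c) w"
    obtain p \<xi> q \<zeta> where vw: "v = (p, \<xi>)" "w = (q, \<zeta>)" by fastforce
    have "snd c p = snd c q" "\<xi> c = \<zeta> c" using e by (auto simp: vw)
    moreover from this have "p = q"
      using is_chart[OF c] v by (auto simp: vw fst_slit_chart is_chart_def inj_on_def)
    ultimately show "v = w"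
      using tangent_space_eqI[of \<xi> p \<zeta> c] v c by (auto simp: vw fst_slit_chart charts_at_def)
  qed
  show m: "(chart_inv c x, tvec_of (chart_inv c x) c y) \<in> fst (slit_chart A c)"
    using ci tvec_of_in_tangent_space[OF ca] y
      component_eq_0_iff[OF tvec_of_in_tangent_space[OF ca] ca, of y] tvec_of_self[OF ca]
    by (simp add: fst_slit_chart)
  show "chart_inv (slit_chart A c) (x, y) = (chart_inv c x, tvec_of (chart_inv c x) c y)"
    unfolding chart_inv_def[of "slit_chart A c"]
    by (rule inv_into_f_eq[OF inj m]) (simp add: ci ca)
qed

text \<open>Turns smoothness of a spray in a bundle chart into smoothness on an explicit product,
  where the fibre variable can be differentiated at a fixed base point.\<close>

lemma slit_chart_image: 
  assumes c: "c \<in> A"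
  shows "snd (slit_chart A c) ` fst (slit_chart A c) = (snd c ` fst c) \<times> (- {0::'e})"
proof (intro equalityI subsetI)
  fix z assume "z \<in> snd (slit_chart A c) ` fst (slit_chart A c)"
  then obtain p \<xi> where "p \<in> fst c" "\<xi> \<in> tangent_space A p" "\<xi> \<noteq> 0" "z = (snd c p, \<xi> c)"
    by (auto simp: slit_chart_def)
  then show "z \<in> (snd c ` fst c) \<times> (- {0::'e})"
    using component_eq_0_iff[of \<xi> p c] c by (auto simp: charts_at_def)
next
  fix z assume "z \<in> (snd c ` fst c) \<times> (- {0::'e})"
  then obtain x y where z: "z = (x, y)" and x: "x \<in> snd c ` fst c" "y \<noteq> 0" by auto
  have ci: "chart_inv c x \<in> fst c" "snd c (chart_inv c x) = x"
    using chart_inv_image[OF x(1) is_chart[OF c]] by auto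
  then have "c \<in> charts_at A (chart_inv c x)" using c by (simp add: charts_at_def)
  then show "z \<in> snd (slit_chart A c) ` fst (slit_chart A c)"
    using chart_inv_slit_chart(2)[OF c x] ci
    by (intro image_eqI[of _ _ "(chart_inv c x, tvec_of (chart_inv c x) c y)"]) (simp_all add: z)
qed

text \<open>The bundle coordinates change by \<open>(x, y)\<close> to the pair of
  \<open>\<tau> x\<close> and the derivative of \<open>\<tau>\<close> at \<open>x\<close> applied to
  \<open>y\<close>. The derivative is block triangular, with a second derivative of
  \<open>\<tau>\<close> in the corner.\<close>

lemma slit_transition_has_derivative:
  assumes c: "c \<in> charts_at A p" and d: "d \<in> charts_at A p"
    and \<xi>: "\<xi> \<in> tangent_space A p" "\<xi> \<noteq> 0"
  defines "\<tau> \<equiv> snd d \<circ> chart_inv c"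
  shows "((snd (slit_chart A d) \<circ> chart_inv (slit_chart A c)) has_derivative
     (\<lambda>(a, b). (frechet_derivative \<tau> (at (snd c p)) a,
        frechet_derivative (\<lambda>z. frechet_derivative \<tau> (at z) (\<xi> c)) (at (snd c p)) a
        + frechet_derivative \<tau> (at (snd c p)) b))) (at (snd c p, \<xi> c))"
proof -
  define W where "W = snd c ` (fst c \<inter> fst d)"
  have W: "open W" "smooth_on W \<tau>" "snd c p \<in> W"
    unfolding W_def \<tau>_def by (rule transition_at[OF c d])+
  have "((\<lambda>z. \<tau> (fst z)) has_derivative (\<lambda>h. frechet_derivative \<tau> (at (snd c p)) (fst h))) (at (snd c p, \<xi> c))"
    using has_derivative_compose[OF has_derivative_fst[OF has_derivative_ident, of "at (snd c p, \<xi> c)"], of \<tau>]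
      smooth_on_has_derivative[OF W(2,3)] by simp
  from has_derivative_Pair[OF this smooth_on_tangent_has_derivative[OF W]]
  have H: "((\<lambda>z. (\<tau> (fst z), case z of (x, y) \<Rightarrow> frechet_derivative \<tau> (at x) y)) has_derivative
     (\<lambda>(a, b). (frechet_derivative \<tau> (at (snd c p)) a,
        frechet_derivative (\<lambda>z. frechet_derivative \<tau> (at z) (\<xi> c)) (at (snd c p)) a
        + frechet_derivative \<tau> (at (snd c p)) b))) (at (snd c p, \<xi> c))"
    by (rule has_derivative_eq_rhs) (simp add: fun_eq_iff split_beta)
  show ?thesis
  proof (rule has_derivative_transform_within_open[OF H])
    show "open (W \<times> (- {0::'e}))" using W by (intro open_Times) auto
    show "(snd c p, \<xi> c) \<in> W \<times> - {0}" using W component_eq_0_iff[OF \<xi>(1) c] \<xi> by simp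
  next
    fix z assume "z \<in> W \<times> - {0::'e}"
    then obtain x y where z: "z = (x, y)" "x \<in> W" "y \<noteq> 0" by auto
    then have x: "x \<in> snd c ` fst c" unfolding W_def by auto
    have ci: "chart_inv c x \<in> fst c \<inter> fst d" "snd c (chart_inv c x) = x"
      using chart_inv_image[OF z(2)[unfolded W_def] is_chart_at[OF c]] by auto
    then have "d \<in> charts_at A (chart_inv c x)" using d by (simp add: charts_at_def)
    then show "(\<tau> (fst z), case z of (x, y) \<Rightarrow> frechet_derivative \<tau> (at x) y)
       = (snd (slit_chart A d) \<circ> chart_inv (slit_chart A c)) z"
      using chart_inv_slit_chart(1)[OF charts_atD(1)[OF c] x z(3)] ci
      by (simp add: z(1) \<tau>_def tvec_of_def)
  qed
qed

text \<open>The block form spells out when a family is tangent to the slit bundle. Closure under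
  linear combinations and equality from a single chart are read off from it, so the general results
  on atlases need not be instantiated for \<open>slit_atlas A\<close>.\<close>

lemma slit_tangent_space_iff:
  assumes \<xi>: "\<xi> \<in> tangent_space A p" "\<xi> \<noteq> 0"
  shows "Z \<in> tangent_space (slit_atlas A) (p, \<xi>) \<longleftrightarrow>
    (\<forall>k. k \<notin> slit_chart A ` charts_at A p \<longrightarrow> Z k = 0) \<and>
    (\<forall>c\<in>charts_at A p. \<forall>d\<in>charts_at A p. Z (slit_chart A d) =
       (frechet_derivative (snd d \<circ> chart_inv c) (at (snd c p)) (fst (Z (slit_chart A c))),
        frechet_derivative (\<lambda>z. frechet_derivative (snd d \<circ> chart_inv c) (at z) (\<xi> c)) (at (snd c p))
          (fst (Z (slit_chart A c)))
        + frechet_derivative (snd d \<circ> chart_inv c) (at (snd c p)) (snd (Z (slit_chart A c)))))"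
  unfolding tangent_space_def charts_at_slit_atlas[OF assms]
  using frechet_derivative_at[OF slit_transition_has_derivative[OF _ _ assms], symmetric]
  by (simp add: split_beta ball_simps)

lemma slit_tangent_space_linear:
  assumes \<xi>: "\<xi> \<in> tangent_space A p" "\<xi> \<noteq> 0"
  shows "\<lbrakk>Z \<in> tangent_space (slit_atlas A) (p, \<xi>); Z' \<in> tangent_space (slit_atlas A) (p, \<xi>)\<rbrakk>
     \<Longrightarrow> Z + Z' \<in> tangent_space (slit_atlas A) (p, \<xi>)"
    "Z \<in> tangent_space (slit_atlas A) (p, \<xi>) \<Longrightarrow> r *\<^sub>R Z \<in> tangent_space (slit_atlas A) (p, \<xi>)"
proof -
  note iff = slit_tangent_space_iff[OF \<xi>]
  have lin: "linear (frechet_derivative (snd d \<circ> chart_inv c) (at (snd c p)))"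
     "linear (frechet_derivative (\<lambda>z. frechet_derivative (snd d \<circ> chart_inv c) (at z) (\<xi> c)) (at (snd c p)))"
    if "c \<in> charts_at A p" "d \<in> charts_at A p" for c d
    by (rule smooth_on_linear_derivative[OF _ transition_at(3)[OF that]],
      rule transition_at(2)[OF that] smooth_on_derivative[OF transition_at(2)[OF that]])+
  show "Z + Z' \<in> tangent_space (slit_atlas A) (p, \<xi>)"
    if "Z \<in> tangent_space (slit_atlas A) (p, \<xi>)" "Z' \<in> tangent_space (slit_atlas A) (p, \<xi>)"
    unfolding iff
  proof (intro conjI allI impI ballI)
    fix c d assume cd: "c \<in> charts_at A p" "d \<in> charts_at A p"
    show "(Z + Z') (slit_chart A d) =
       (frechet_derivative (snd d \<circ> chart_inv c) (at (snd c p)) (fst ((Z + Z') (slit_chart A c))),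
        frechet_derivative (\<lambda>z. frechet_derivative (snd d \<circ> chart_inv c) (at z) (\<xi> c)) (at (snd c p))
          (fst ((Z + Z') (slit_chart A c)))
        + frechet_derivative (snd d \<circ> chart_inv c) (at (snd c p)) (snd ((Z + Z') (slit_chart A c))))"
      using that[unfolded iff, THEN conjunct2, rule_format, OF cd] lin[OF cd]
      by (simp add: linear_add)
  qed (use that[unfolded iff] in auto)
  show "r *\<^sub>R Z \<in> tangent_space (slit_atlas A) (p, \<xi>)"
    if "Z \<in> tangent_space (slit_atlas A) (p, \<xi>)"
    unfolding iff
  proof (intro conjI allI impI ballI)
    fix c d assume cd: "c \<in> charts_at A p" "d \<in> charts_at A p"
    show "(r *\<^sub>R Z) (slit_chart A d) =
       (frechet_derivative (snd d \<circ> chart_inv c) (at (snd c p)) (fst ((r *\<^sub>R Z) (slit_chart A c))),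
        frechet_derivative (\<lambda>z. frechet_derivative (snd d \<circ> chart_inv c) (at z) (\<xi> c)) (at (snd c p))
          (fst ((r *\<^sub>R Z) (slit_chart A c)))
        + frechet_derivative (snd d \<circ> chart_inv c) (at (snd c p)) (snd ((r *\<^sub>R Z) (slit_chart A c))))"
      using that[unfolded iff, THEN conjunct2, rule_format, OF cd] lin[OF cd]
      by (simp add: linear_cmul scaleR_fun_def scaleR_right_distrib)
  qed (use that[unfolded iff] in \<open>auto simp: scaleR_fun_def\<close>)
qed

lemma slit_tangent_space_eqI:
  assumes \<xi>: "\<xi> \<in> tangent_space A p" "\<xi> \<noteq> 0" and c: "c \<in> charts_at A p"
    and Z: "Z \<in> tangent_space (slit_atlas A) (p, \<xi>)" "Z' \<in> tangent_space (slit_atlas A) (p, \<xi>)"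
      "Z (slit_chart A c) = Z' (slit_chart A c)"
  shows "Z = Z'"
proof
  fix k
  show "Z k = Z' k"
  proof (cases "k \<in> slit_chart A ` charts_at A p")
    case True
    then obtain d where d: "d \<in> charts_at A p" "k = slit_chart A d" by auto
    show ?thesis
      unfolding d(2) Z(1)[unfolded slit_tangent_space_iff[OF \<xi>], THEN conjunct2, rule_format, OF c d(1)]
        Z(2)[unfolded slit_tangent_space_iff[OF \<xi>], THEN conjunct2, rule_format, OF c d(1)] Z(3) ..
  next
    case False
    have "Z k = 0" "Z' k = 0"
      using Z(1,2) False unfolding slit_tangent_space_iff[OF \<xi>] by blast+
    then show ?thesis by simp
  qed
qed

section \<open>Complete lifts and vertical vectors are tangent to the slit bundle\<close>

lemma complete_lift_component:
  assumes \<xi>: "\<xi> \<in> tangent_space A p" "\<xi> \<noteq> 0" and c: "c \<in> charts_at A p"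
  shows "complete_lift A X (p, \<xi>) (slit_chart A c) =
    (X p c, frechet_derivative (in_chart c X) (at (snd c p)) (\<xi> c))"
proof -
  have "the_inv_into A (slit_chart A) (slit_chart A c) = c"
    by (rule the_inv_into_f_f[OF inj_onI charts_atD(1)[OF c]]) (rule slit_chart_inject)
  then show ?thesis
    using c by (simp add: complete_lift_def charts_at_slit_atlas[OF \<xi>])
qed

text \<open>The second derivatives of the coordinate change enter the complete lift and the tangent map
  of the coordinate change with exchanged arguments.\<close>

lemma complete_lift_in_tangent_space:
  assumes \<xi>: "\<xi> \<in> tangent_space A p" "\<xi> \<noteq> 0"
    and X: "\<And>q. q \<in> points A \<Longrightarrow> X q \<in> tangent_space A q"
    and dX: "\<And>c. c \<in> charts_at A p \<Longrightarrow> in_chart c X differentiable (at (snd c p))"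
  shows "complete_lift A X (p, \<xi>) \<in> tangent_space (slit_atlas A) (p, \<xi>)"
  unfolding slit_tangent_space_iff[OF \<xi>]
proof (intro conjI allI impI ballI)
  fix k assume "k \<notin> slit_chart A ` charts_at A p"
  then show "complete_lift A X (p, \<xi>) k = 0"
    by (simp add: complete_lift_def charts_at_slit_atlas[OF \<xi>])
next
  fix c d assume c: "c \<in> charts_at A p" and d: "d \<in> charts_at A p"
  define \<tau> where "\<tau> = snd d \<circ> chart_inv c"
  define W where "W = snd c ` (fst c \<inter> fst d)"
  define x where "x = snd c p"
  have W: "open W" "smooth_on W \<tau>" "x \<in> W"
    unfolding W_def \<tau>_def x_def by (rule transition_at[OF c d])+
  have pA: "p \<in> points A" using c by (auto simp: points_def charts_at_def)
  have ci: "chart_inv c x = p" using is_chart_at[OF c] c by (simp add: x_def charts_at_def)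
  have \<tau>x: "\<tau> x = snd d p" by (simp add: \<tau>_def ci)
  have X\<tau>: "frechet_derivative \<tau> (at x) (X p c) = X p d"
    using tangent_spaceD(2)[OF X[OF pA] c d] by (simp add: \<tau>_def x_def)
  have \<xi>\<tau>: "frechet_derivative \<tau> (at x) (\<xi> c) = \<xi> d"
    using tangent_spaceD(2)[OF \<xi>(1) c d] by (simp add: \<tau>_def x_def)
  \<comment> \<open>The expression of \<open>X\<close> in \<open>d\<close>, pulled back by
    \<open>\<tau>\<close>, is differentiated in two ways: by the chain rule here, and in
    \<open>R\<close> through the transformation law of \<open>X\<close>. Equating the two gives the
    vertical part of the lift in \<open>d\<close>.\<close>
  have L: "((\<lambda>z. in_chart d X (\<tau> z)) has_derivative
      (\<lambda>v. frechet_derivative (in_chart d X) (at (snd d p)) (frechet_derivative \<tau> (at x) v))) (at x)"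
    using dX[OF d] by (intro has_derivative_compose[OF smooth_on_has_derivative[OF W(2,3)]])
      (simp add: frechet_derivative_works \<tau>x)
  have P: "((\<lambda>z. (z, in_chart c X z)) has_derivative
      (\<lambda>v. (v, frechet_derivative (in_chart c X) (at x) v))) (at x)"
    using dX[OF c] by (intro has_derivative_Pair has_derivative_ident)
      (simp add: frechet_derivative_works x_def)
  have "((\<lambda>z. frechet_derivative \<tau> (at z) (in_chart c X z)) has_derivative
      (\<lambda>v. frechet_derivative (\<lambda>z. frechet_derivative \<tau> (at z) (X p c)) (at x) v
         + frechet_derivative \<tau> (at x) (frechet_derivative (in_chart c X) (at x) v))) (at x)"
    using has_derivative_compose[OF P smooth_on_tangent_has_derivative[OF W]]
    by (simp add: in_chart_def ci)
  then have R: "((\<lambda>z. in_chart d X (\<tau> z)) has_derivative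
      (\<lambda>v. frechet_derivative (\<lambda>z. frechet_derivative \<tau> (at z) (X p c)) (at x) v
         + frechet_derivative \<tau> (at x) (frechet_derivative (in_chart c X) (at x) v))) (at x)"
  proof (rule has_derivative_transform_within_open[OF _ W(1,3)])
    fix z assume z: "z \<in> W"
    have q: "chart_inv c z \<in> fst c \<inter> fst d" "snd c (chart_inv c z) = z"
      using chart_inv_image[OF z[unfolded W_def] is_chart_at[OF c]] by auto
    then have cd: "c \<in> charts_at A (chart_inv c z)" "d \<in> charts_at A (chart_inv c z)"
      using c d by (auto simp: charts_at_def)
    then have "chart_inv c z \<in> points A" by (auto simp: points_def charts_at_def)
    from tangent_spaceD(2)[OF X[OF this] cd] q
    show "frechet_derivative \<tau> (at z) (in_chart c X z) = in_chart d X (\<tau> z)"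
      using is_chart_at[OF d] by (simp add: in_chart_def \<tau>_def)
  qed
  have "frechet_derivative (in_chart d X) (at (snd d p)) (\<xi> d) =
      frechet_derivative (\<lambda>z. frechet_derivative \<tau> (at z) (X p c)) (at x) (\<xi> c)
         + frechet_derivative \<tau> (at x) (frechet_derivative (in_chart c X) (at x) (\<xi> c))"
    using has_derivative_unique[OF L R] \<xi>\<tau> by metis
  also have "frechet_derivative (\<lambda>z. frechet_derivative \<tau> (at z) (X p c)) (at x) (\<xi> c)
     = frechet_derivative (\<lambda>z. frechet_derivative \<tau> (at z) (\<xi> c)) (at x) (X p c)"
    by (rule smooth_on_second_derivative_symmetric[OF W])
  finally show "complete_lift A X (p, \<xi>) (slit_chart A d) =
       (frechet_derivative (snd d \<circ> chart_inv c) (at (snd c p))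
          (fst (complete_lift A X (p, \<xi>) (slit_chart A c))),
        frechet_derivative (\<lambda>z. frechet_derivative (snd d \<circ> chart_inv c) (at z) (\<xi> c)) (at (snd c p))
          (fst (complete_lift A X (p, \<xi>) (slit_chart A c)))
        + frechet_derivative (snd d \<circ> chart_inv c) (at (snd c p))
          (snd (complete_lift A X (p, \<xi>) (slit_chart A c))))"
    unfolding complete_lift_component[OF \<xi> c] complete_lift_component[OF \<xi> d] fst_conv snd_conv
      \<tau>_def[symmetric] x_def[symmetric] X\<tau> by (rule arg_cong)
qed

lemma vertical_velocity_component:
  assumes \<xi>: "\<xi> \<in> tangent_space A p" "\<xi> \<noteq> 0" and c: "c \<in> charts_at A p"
  shows "velocity (slit_atlas A) (\<lambda>s. (p, \<xi> + s *\<^sub>R \<zeta>)) 0 (slit_chart A c) = (0, \<zeta> c)"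
proof -
  have "((\<lambda>s. (snd c p, \<xi> c + s *\<^sub>R \<zeta> c)) has_vector_derivative (0, \<zeta> c)) (at 0)"
    by (auto intro!: derivative_eq_intros)
  then have "((\<lambda>s. (snd c p, \<xi> c + (s *\<^sub>R \<zeta>) c)) has_vector_derivative (0, \<zeta> c)) (at 0)"
    by (simp add: scaleR_fun_def)
  then show ?thesis
    using c by (simp add: velocity_def charts_at_slit_atlas[OF \<xi>] vector_derivative_at)
qed

lemma vertical_velocity_in_tangent_space:
  assumes \<xi>: "\<xi> \<in> tangent_space A p" "\<xi> \<noteq> 0" and \<zeta>: "\<zeta> \<in> tangent_space A p"
  shows "velocity (slit_atlas A) (\<lambda>s. (p, \<xi> + s *\<^sub>R \<zeta>)) 0 \<in> tangent_space (slit_atlas A) (p, \<xi>)"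
  unfolding slit_tangent_space_iff[OF \<xi>]
proof (intro conjI allI impI ballI)
  fix k assume "k \<notin> slit_chart A ` charts_at A p"
  then show "velocity (slit_atlas A) (\<lambda>s. (p, \<xi> + s *\<^sub>R \<zeta>)) 0 k = 0"
    by (simp add: velocity_def charts_at_slit_atlas[OF \<xi>])
next
  fix c d assume cd: "c \<in> charts_at A p" "d \<in> charts_at A p"
  \<comment> \<open>The horizontal part is zero, so the second derivative term is a linear map
    evaluated at 0.\<close>
  note D = linear_0[OF smooth_on_linear_derivative[OF smooth_on_derivative[OF transition_at(2)[OF cd]]
        transition_at(3)[OF cd]]]
  show "velocity (slit_atlas A) (\<lambda>s. (p, \<xi> + s *\<^sub>R \<zeta>)) 0 (slit_chart A d) =
       (frechet_derivative (snd d \<circ> chart_inv c) (at (snd c p))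
          (fst (velocity (slit_atlas A) (\<lambda>s. (p, \<xi> + s *\<^sub>R \<zeta>)) 0 (slit_chart A c))),
        frechet_derivative (\<lambda>z. frechet_derivative (snd d \<circ> chart_inv c) (at z) (\<xi> c)) (at (snd c p))
          (fst (velocity (slit_atlas A) (\<lambda>s. (p, \<xi> + s *\<^sub>R \<zeta>)) 0 (slit_chart A c)))
        + frechet_derivative (snd d \<circ> chart_inv c) (at (snd c p))
          (snd (velocity (slit_atlas A) (\<lambda>s. (p, \<xi> + s *\<^sub>R \<zeta>)) 0 (slit_chart A c))))"
    using tangent_spaceD(2)[OF \<zeta> cd] linear_0[OF transition_linear[OF cd]] D
    by (simp add: vertical_velocity_component[OF \<xi>] cd)
qed

end

section \<open>Left translations and left invariant fields\<close>

locale lie_group_atlas =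
  fixes G :: "('g, 'm) monoid_scheme" (structure)
    and A :: "('g, 'e::euclidean_space) chart set"
  assumes lie: "lie_group G A"
begin

sublocale group G
  using lie by (simp add: lie_group_def)

sublocale atlas A
  using lie by unfold_locales (simp add: lie_group_def smooth_manifold_def maximal_atlas_def)

abbreviation L :: "'g \<Rightarrow> 'g \<Rightarrow> 'g"
  where "L \<equiv> left_translation G"

abbreviation LIF :: "('g, 'e) tvec \<Rightarrow> 'g \<Rightarrow> ('g, 'e) tvec"
  where "LIF \<equiv> left_invariant_field G A"

lemma points_eq_carrier: "points A = carrier G"
  using lie by (simp add: lie_group_def)

lemma chart_subset_carrier:
  assumes "c \<in> A"
  shows "fst c \<subseteq> carrier G"
  using assms points_eq_carrier by (force simp: points_def)

lemma charts_at_carrier: "c \<in> charts_at A g \<Longrightarrow> g \<in> carrier G"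
  by (rule subsetD[OF chart_subset_carrier[OF charts_atD(1)] charts_atD(2)])

lemma ex_chart_at: "g \<in> carrier G \<Longrightarrow> \<exists>c. c \<in> charts_at A g"
  by (rule charts_at_nonempty) (simp add: points_eq_carrier)

text \<open>Kept in both variables: freezing the first gives left translations, whereas the
  derivative in the second, viewed as a function of the first, gives left invariant fields.\<close>

lemma mult_in_charts:
  assumes b: "b \<in> A" and c: "c \<in> A" and d: "d \<in> A"
  defines "W \<equiv> {(x, y). x \<in> snd b ` fst b \<and> y \<in> snd c ` fst c \<and> chart_inv b x \<otimes> chart_inv c y \<in> fst d}"
  shows "open W" "smooth_on W (\<lambda>(x, y). snd d (chart_inv b x \<otimes> chart_inv c y))"
proof -
  define P where "P = (fst b \<times> fst c, map_prod (snd b) (snd c))"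
  have P: "P \<in> prod_atlas A A" using b c unfolding P_def prod_atlas_def by blast
  have inj: "inj_on (snd P) (fst P)"
    using is_chart[OF b] is_chart[OF c] by (simp add: P_def is_chart_def map_prod_inj_on)
  have inv: "chart_inv P (x, y) = (chart_inv b x, chart_inv c y)"
    if "x \<in> snd b ` fst b" "y \<in> snd c ` fst c" for x y
    unfolding chart_inv_def[of P]
    by (rule inv_into_f_eq[OF inj])
      (use chart_inv_image[OF that(1) is_chart[OF b]] chart_inv_image[OF that(2) is_chart[OF c]]
        in \<open>simp_all add: P_def\<close>)
  have W: "W = snd P ` (fst P \<inter> (\<lambda>(g, h). g \<otimes> h) -` fst d)"
  proof (intro equalityI subsetI)
    fix z assume "z \<in> W"
    then obtain x y where z: "z = (x, y)" and x: "x \<in> snd b ` fst b" and y: "y \<in> snd c ` fst c"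
      and m: "chart_inv b x \<otimes> chart_inv c y \<in> fst d" by (auto simp: W_def)
    show "z \<in> snd P ` (fst P \<inter> (\<lambda>(g, h). g \<otimes> h) -` fst d)"
      using chart_inv_image[OF x is_chart[OF b]] chart_inv_image[OF y is_chart[OF c]] m
      by (intro image_eqI[of _ _ "(chart_inv b x, chart_inv c y)"]) (auto simp: z P_def)
  next
    fix z assume "z \<in> snd P ` (fst P \<inter> (\<lambda>(g, h). g \<otimes> h) -` fst d)"
    then show "z \<in> W"
      using is_chart[OF b] is_chart[OF c] by (auto simp: W_def P_def)
  qed
  have sm: "smooth_map (prod_atlas A A) A (\<lambda>(g, h). g \<otimes> h)"
    using lie by (simp add: lie_group_def)
  show o: "open W"
    using sm P d unfolding smooth_map_def W by blast
  have "smooth_on W (snd d \<circ> (\<lambda>(g, h). g \<otimes> h) \<circ> chart_inv P)"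
    using sm P d unfolding smooth_map_def W by blast
  then show "smooth_on W (\<lambda>(x, y). snd d (chart_inv b x \<otimes> chart_inv c y))"
    by (rule smooth_on_cong[OF o, rotated]) (use inv in \<open>auto simp: W_def\<close>)
qed

lemma left_translation_smooth:
  assumes g: "g \<in> carrier G"
  shows "smooth_map A A (L g)"
  unfolding smooth_map_def
proof (intro conjI ballI)
  show "L g ` points A \<subseteq> points A"
    using g by (auto simp: points_eq_carrier left_translation_def)
  fix c d assume c: "c \<in> A" and d: "d \<in> A"
  obtain b where b: "b \<in> charts_at A g" using ex_chart_at[OF g] ..
  note bA = charts_atD(1)[OF b] and bg = charts_atD(2)[OF b]
  note W = mult_in_charts[OF bA c d]
  let ?W = "{(x, y). x \<in> snd b ` fst b \<and> y \<in> snd c ` fst c \<and> chart_inv b x \<otimes> chart_inv c y \<in> fst d}"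
  have bi: "chart_inv b (snd b g) = g" using is_chart[OF bA] bg by simp
  have eq: "{y. (snd b g, y) \<in> ?W} = snd c ` (fst c \<inter> L g -` fst d)"
    using bg is_chart[OF c] by (auto simp: bi left_translation_def)
  show o: "open (snd c ` (fst c \<inter> L g -` fst d))"
    using open_slice[OF W(1), of "snd b g"] unfolding eq .
  show "smooth_on (snd c ` (fst c \<inter> L g -` fst d)) (snd d \<circ> L g \<circ> chart_inv c)"
    using smooth_on_slice[OF W, of "snd b g"] unfolding eq
    by (rule smooth_on_cong[OF o, rotated]) (simp add: bi left_translation_def)
qed

text \<open>A relation and not a construction: chart maps have arbitrary values outside their
  domains, so translating a chart forth and back need not return the same pair. The relation is
  symmetric under inverting \<open>g\<close>, and this produces a translate that ends exactly at a
  prescribed chart.\<close>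

definition translated_chart :: "'g \<Rightarrow> ('g, 'e) chart \<Rightarrow> ('g, 'e) chart \<Rightarrow> bool"
  where "translated_chart g c d \<longleftrightarrow> g \<in> carrier G \<and> c \<in> A \<and> d \<in> A \<and> fst d = L g ` fst c \<and>
    (\<forall>h\<in>fst c. snd d (g \<otimes> h) = snd c h)"

lemma translated_chartD:
  assumes "translated_chart g c d"
  shows "g \<in> carrier G" "c \<in> A" "d \<in> A" "fst d = L g ` fst c"
    "\<And>h. h \<in> fst c \<Longrightarrow> snd d (g \<otimes> h) = snd c h"
  using assms by (auto simp: translated_chart_def)

text \<open>Maximality of the atlas enters here. The translated chart is compatible with each chart
  \<open>b\<close> because the two transitions are \<open>L g\<close> and \<open>L (inv g)\<close>
  read in \<open>c\<close> and \<open>b\<close>.\<close>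

lemma ex_translated_chart:
  assumes g: "g \<in> carrier G" and c: "c \<in> A"
  obtains d where "translated_chart g c d"
proof -
  define d where "d = (L g ` fst c, \<lambda>h. snd c (inv g \<otimes> h))"
  have sub: "fst c \<subseteq> carrier G" by (rule chart_subset_carrier[OF c])
  have inv: "inv g \<otimes> (g \<otimes> h) = h" "g \<otimes> (inv g \<otimes> h) = h" if "h \<in> carrier G" for h
    using g that by (simp_all add: m_assoc[symmetric])
  have dg: "snd d (g \<otimes> h) = snd c h" if "h \<in> fst c" for h
    using inv sub that by (auto simp: d_def)
  have fd: "fst d = L g ` fst c" by (simp add: d_def)
  have im: "snd d ` L g ` P = snd c ` P" if "P \<subseteq> fst c" for P
    using dg that by (force simp: left_translation_def image_iff)
  have ch: "is_chart d"
    unfolding is_chart_def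
  proof
    show "inj_on (snd d) (fst d)"
      using is_chart[OF c] dg by (auto simp: fd is_chart_def inj_on_def left_translation_def)
    show "open (snd d ` fst d)"
      using is_chart[OF c] im[of "fst c"] by (simp add: fd is_chart_def)
  qed
  have di: "chart_inv d x = g \<otimes> chart_inv c x" if "x \<in> snd c ` fst c" for x
    using chart_inv_image[OF that is_chart[OF c]] dg[of "chart_inv c x"]
      chart_inv_chart[OF ch, of "g \<otimes> chart_inv c x"] by (simp add: fd left_translation_def)
  have comp: "compatible d b" if b: "b \<in> A" for b
  proof -
    have bsub: "fst b \<subseteq> carrier G" by (rule chart_subset_carrier[OF b])
    have 1: "fst d \<inter> fst b = L g ` (fst c \<inter> L g -` fst b)" by (auto simp: fd)
    have sm1: "open (snd c ` (fst c \<inter> L g -` fst b))"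
      "smooth_on (snd c ` (fst c \<inter> L g -` fst b)) (snd b \<circ> L g \<circ> chart_inv c)"
      using left_translation_smooth[OF g] b c unfolding smooth_map_def by blast+
    have 2: "fst b \<inter> fst d = fst b \<inter> L (inv g) -` fst c"
    proof (intro equalityI subsetI)
      fix h assume "h \<in> fst b \<inter> fst d"
      then show "h \<in> fst b \<inter> L (inv g) -` fst c"
        using inv sub by (auto simp: fd left_translation_def)
    next
      fix h assume h: "h \<in> fst b \<inter> L (inv g) -` fst c"
      then have "h = L g (inv g \<otimes> h)" using inv(2)[of h] bsub by (auto simp: left_translation_def)
      then show "h \<in> fst b \<inter> fst d" using h by (auto simp: fd left_translation_def)
    qed
    have sm2: "open (snd b ` (fst b \<inter> L (inv g) -` fst c))"
      "smooth_on (snd b ` (fst b \<inter> L (inv g) -` fst c)) (snd c \<circ> L (inv g) \<circ> chart_inv b)"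
      using left_translation_smooth[of "inv g"] g b c unfolding smooth_map_def by auto
    have "smooth_transition d b"
      unfolding smooth_transition_def 1 im[OF Int_lower1]
      by (intro conjI sm1(1), rule smooth_on_cong[OF sm1(1) _ sm1(2)])
        (use di is_chart[OF c] in \<open>auto simp: left_translation_def\<close>)
    moreover have "smooth_transition b d"
      unfolding smooth_transition_def 2
      by (intro conjI sm2(1), rule smooth_on_cong[OF sm2(1) _ sm2(2)])
        (auto simp: left_translation_def d_def)
    ultimately show ?thesis by (simp add: compatible_def)
  qed
  have "maximal_atlas A" using lie by (simp add: lie_group_def smooth_manifold_def)
  moreover have "fst d \<subseteq> points A"
    using sub g by (auto simp: fd points_eq_carrier left_translation_def)
  ultimately have "d \<in> A" using ch comp unfolding maximal_atlas_def by blast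
  with g c dg fd show thesis by (intro that[of d]) (simp add: translated_chart_def)
qed

lemma translated_chart_sym:
  assumes t: "translated_chart g c d"
  shows "translated_chart (inv g) d c"
proof -
  note T = translated_chartD[OF t]
  have sub: "h \<in> carrier G" if "h \<in> fst c" for h
    using chart_subset_carrier[OF T(2)] that by blast
  have inv: "inv g \<otimes> (g \<otimes> h) = h" if "h \<in> fst c" for h
    using T(1) sub[OF that] by (simp add: m_assoc[symmetric])
  have "L (inv g) ` L g ` fst c = (\<lambda>h. h) ` fst c"
    unfolding image_image by (rule image_cong) (use inv in \<open>simp_all add: left_translation_def\<close>)
  then have "fst c = L (inv g) ` fst d" by (simp add: T(4))
  moreover have "snd c (inv g \<otimes> k) = snd d k" if k: "k \<in> fst d" for k
    using k inv T(5) unfolding T(4) left_translation_def by auto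
  ultimately show ?thesis using T(1-3) by (simp add: translated_chart_def)
qed

text \<open>Pulls a given chart back: it is pushed by \<open>inv g\<close>, and symmetry of the
  relation is applied.\<close>

lemma ex_translated_chart':
  assumes g: "g \<in> carrier G" and d: "d \<in> A"
  obtains c where "translated_chart g c d"
proof -
  obtain c where c: "translated_chart (inv g) d c"
    using ex_translated_chart[of "inv g" d] g d by auto
  show thesis using translated_chart_sym[OF c] g by (intro that[of c]) simp
qed

lemma translated_charts_at:
  assumes t: "translated_chart g c d" and h: "h \<in> fst c"
  shows "c \<in> charts_at A h" "d \<in> charts_at A (g \<otimes> h)" "snd d (g \<otimes> h) = snd c h"
  using translated_chartD[OF t] h by (auto simp: charts_at_def left_translation_def)

lemma translated_chart_inv:
  assumes t: "translated_chart g c d" and x: "x \<in> snd c ` fst c"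
  shows "x \<in> snd d ` fst d" "chart_inv d x = g \<otimes> chart_inv c x"
proof -
  have ci: "chart_inv c x \<in> fst c" "snd c (chart_inv c x) = x"
    using chart_inv_image[OF x is_chart[OF translated_chartD(2)[OF t]]] by auto
  have m: "g \<otimes> chart_inv c x \<in> fst d"
    using translated_charts_at(2)[OF t ci(1)] by (rule charts_atD(2))
  have e: "snd d (g \<otimes> chart_inv c x) = x"
    using translated_charts_at(3)[OF t ci(1)] ci(2) by simp
  show "x \<in> snd d ` fst d" using m e by (metis image_eqI)
  show "chart_inv d x = g \<otimes> chart_inv c x"
    using chart_inv_chart[OF is_chart[OF translated_chartD(3)[OF t]] m] e by simp
qed

lemma left_translation_in_tangent_space:
  assumes g: "g \<in> carrier G" and h: "h \<in> carrier G" and \<xi>: "\<xi> \<in> tangent_space A h"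
  shows "pushforward A A (L g) h \<xi> \<in> tangent_space A (g \<otimes> h)"
  using pushforward_in_tangent_space[OF smooth smooth left_translation_smooth[OF g] _ \<xi>] h
  by (simp add: points_eq_carrier left_translation_def)

lemma left_translation_component:
  assumes g: "g \<in> carrier G" and c: "c \<in> charts_at A h" and d: "d \<in> charts_at A (g \<otimes> h)"
    and \<xi>: "\<xi> \<in> tangent_space A h"
  shows "pushforward A A (L g) h \<xi> d = frechet_derivative (snd d \<circ> L g \<circ> chart_inv c) (at (snd c h)) (\<xi> c)"
  using pushforward_component[OF smooth smooth left_translation_smooth[OF g] c _ \<xi>] d
  by (simp add: left_translation_def)

lemma left_translation_translated_chart:
  assumes t: "translated_chart g c d" and h: "h \<in> fst c" and \<xi>: "\<xi> \<in> tangent_space A h"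
  shows "pushforward A A (L g) h \<xi> d = \<xi> c"
proof -
  note at = translated_charts_at[OF t h]
  have "frechet_derivative (snd d \<circ> L g \<circ> chart_inv c) (at (snd c h))
      = frechet_derivative (\<lambda>x. x) (at (snd c h))"
  proof (rule frechet_derivative_cong_open)
    show "open (snd c ` fst c)" using is_chart_at[OF at(1)] by (simp add: is_chart_def)
    show "snd c h \<in> snd c ` fst c" using h by blast
    show "(snd d \<circ> L g \<circ> chart_inv c) x = x" if "x \<in> snd c ` fst c" for x
      using chart_inv_image[OF that is_chart_at[OF at(1)]] translated_chartD(5)[OF t]
      by (simp add: left_translation_def)
  qed
  then show ?thesis
    using left_translation_component[OF translated_chartD(1)[OF t] at(1,2) \<xi>] by simp
qed

section \<open>Left invariant fields and their derivatives at the identity\<close>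

lemma LIF_in_tangent_space:
  assumes "\<xi> \<in> tangent_space A \<one>" "g \<in> carrier G"
  shows "LIF \<xi> g \<in> tangent_space A g"
  using left_translation_in_tangent_space[OF assms(2) one_closed assms(1)] assms(2)
  by (simp add: left_invariant_field_def)

lemma LIF_component:
  assumes b: "b \<in> charts_at A \<one>" and d: "d \<in> charts_at A g" and \<xi>: "\<xi> \<in> tangent_space A \<one>"
  shows "LIF \<xi> g d = frechet_derivative (snd d \<circ> L g \<circ> chart_inv b) (at (snd b \<one>)) (\<xi> b)"
  using left_translation_component[OF charts_at_carrier[OF d] b _ \<xi>] d charts_at_carrier[OF d]
  by (simp add: left_invariant_field_def)

lemma LIF_component_differentiable:
  assumes b: "b \<in> charts_at A \<one>" and d: "d \<in> charts_at A g"
  shows "(snd d \<circ> L g \<circ> chart_inv b) differentiable (at (snd b \<one>))"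
proof -
  have g: "g \<in> carrier G" by (rule charts_at_carrier[OF d])
  then have "d \<in> charts_at A (L g \<one>)" using d by (simp add: left_translation_def)
  note W = smooth_map_in_charts[OF left_translation_smooth[OF g] b this]
  show ?thesis by (rule smooth_on_differentiable[OF W(3,2)])
qed

text \<open>Every chart around the identity is its own translate by the identity, so the components
  do not change.\<close>

lemma LIF_one:
  assumes \<xi>: "\<xi> \<in> tangent_space A \<one>"
  shows "LIF \<xi> \<one> = \<xi>"
proof -
  obtain c where c: "c \<in> charts_at A \<one>" using ex_chart_at[OF one_closed] ..
  have sub: "fst c \<subseteq> carrier G" by (rule chart_subset_carrier[OF charts_atD(1)[OF c]])
  have "(L \<one>) ` fst c = (\<lambda>h. h) ` fst c"
    by (rule image_cong) (use sub in \<open>auto simp: left_translation_def\<close>)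
  then have "translated_chart \<one> c c"
    using subsetD[OF sub] charts_atD[OF c] by (simp add: translated_chart_def)
  then have "LIF \<xi> \<one> c = \<xi> c"
    using left_translation_translated_chart[OF _ charts_atD(2)[OF c] \<xi>]
    by (simp add: left_invariant_field_def)
  then show ?thesis
    using tangent_space_eqI[OF LIF_in_tangent_space[OF \<xi> one_closed] \<xi> c] by simp
qed

text \<open>By associativity, \<open>L (g \<otimes> h)\<close> read in \<open>d\<close> is the same
  map as \<open>L h\<close> read in \<open>c\<close>, already before differentiating at the
  identity.\<close>

lemma LIF_translated_chart:
  assumes t: "translated_chart g c d" and h: "h \<in> fst c" and \<xi>: "\<xi> \<in> tangent_space A \<one>"
  shows "LIF \<xi> (g \<otimes> h) d = LIF \<xi> h c"
proof -
  note at = translated_charts_at[OF t h]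
  have g: "g \<in> carrier G" by (rule translated_chartD(1)[OF t])
  have hG: "h \<in> carrier G" by (rule charts_at_carrier[OF at(1)])
  obtain b where b: "b \<in> charts_at A \<one>" using ex_chart_at[OF one_closed] ..
  have c': "c \<in> charts_at A (L h \<one>)" using at(1) hG by (simp add: left_translation_def)
  note W = smooth_map_in_charts[OF left_translation_smooth[OF hG] b c']
  have bsub: "fst b \<subseteq> carrier G" by (rule chart_subset_carrier[OF charts_atD(1)[OF b]])
  have "frechet_derivative (snd d \<circ> L (g \<otimes> h) \<circ> chart_inv b) (at (snd b \<one>))
      = frechet_derivative (snd c \<circ> L h \<circ> chart_inv b) (at (snd b \<one>))"
  proof (rule frechet_derivative_cong_open[OF W(1,2)])
    fix x assume x: "x \<in> snd b ` (fst b \<inter> L h -` fst c)"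
    have q: "chart_inv b x \<in> fst b \<inter> L h -` fst c"
      using chart_inv_image[OF x is_chart_at[OF b]] by auto
    then show "(snd d \<circ> L (g \<otimes> h) \<circ> chart_inv b) x = (snd c \<circ> L h \<circ> chart_inv b) x"
      using translated_chartD(5)[OF t, of "h \<otimes> chart_inv b x"] g hG bsub
      by (auto simp: left_translation_def m_assoc)
  qed
  then show ?thesis
    using LIF_component[OF b at(2) \<xi>] LIF_component[OF b at(1) \<xi>] by simp
qed

text \<open>Recovers the field along the curve from its translate to the identity. The chain rule
  applies to \<open>L g\<close> after \<open>L (inv g)\<close>, which is the identity map near
  \<open>g\<close>.\<close>

lemma LIF_left_translation:
  assumes g: "g \<in> carrier G" and \<xi>: "\<xi> \<in> tangent_space A g"
  shows "LIF (pushforward A A (L (inv g)) g \<xi>) g = \<xi>"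
proof -
  obtain d where d: "d \<in> charts_at A g" using ex_chart_at[OF g] ..
  obtain b where b: "b \<in> charts_at A \<one>" using ex_chart_at[OF one_closed] ..
  have ig: "inv g \<in> carrier G" using g by simp
  have b': "b \<in> charts_at A (inv g \<otimes> g)" using b g by simp
  define \<zeta> where "\<zeta> = pushforward A A (L (inv g)) g \<xi>"
  have \<zeta>: "\<zeta> \<in> tangent_space A \<one>"
    using left_translation_in_tangent_space[OF ig g \<xi>] g by (simp add: \<zeta>_def)
  have Lg: "L (inv g) g = \<one>" using g by (simp add: left_translation_def)
  have b'': "b \<in> charts_at A (L (inv g) g)" using b' by (simp add: left_translation_def)
  have df: "(snd d \<circ> L g \<circ> chart_inv b) differentiable (at (snd b (L (inv g) g)))"
    using LIF_component_differentiable[OF b d] g by (simp add: left_translation_def)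
  have sub: "fst d \<subseteq> carrier G" by (rule chart_subset_carrier[OF charts_atD(1)[OF d]])
  have "frechet_derivative (snd d \<circ> L g \<circ> L (inv g) \<circ> chart_inv d) (at (snd d g))
      = frechet_derivative (\<lambda>x. x) (at (snd d g))"
  proof (rule frechet_derivative_cong_open)
    show "open (snd d ` fst d)" using is_chart_at[OF d] by (simp add: is_chart_def)
    show "snd d g \<in> snd d ` fst d" using charts_atD[OF d] by blast
    fix x assume x: "x \<in> snd d ` fst d"
    note q = chart_inv_image[OF x is_chart_at[OF d] order_refl]
    then have "g \<otimes> (inv g \<otimes> chart_inv d x) = chart_inv d x"
      using g sub by (auto simp: m_assoc[symmetric])
    then show "(snd d \<circ> L g \<circ> L (inv g) \<circ> chart_inv d) x = x"
      using q by (simp add: left_translation_def)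
  qed
  moreover have "frechet_derivative (snd d \<circ> L g \<circ> L (inv g) \<circ> chart_inv d) (at (snd d g)) (\<xi> d)
     = LIF \<zeta> g d"
    using fun_cong[OF frechet_derivative_at[OF chain_rule_in_charts[where h = "snd d \<circ> L g",
            OF smooth smooth left_translation_smooth[OF ig] d b'' df]], of "\<xi> d"]
      left_translation_component[OF ig d b' \<xi>] LIF_component[OF b d \<zeta>]
    by (simp add: \<zeta>_def Lg)
  ultimately have "LIF \<zeta> g d = \<xi> d" by simp
  then have "LIF \<zeta> g = \<xi>"
    using tangent_space_eqI[OF LIF_in_tangent_space[OF \<zeta> g] \<xi> d] by simp
  then show ?thesis by (simp add: \<zeta>_def)
qed

lemma LIF_linear:
  assumes "\<xi> \<in> tangent_space A \<one>" "\<zeta> \<in> tangent_space A \<one>" "d \<in> charts_at A g"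
  shows "LIF (\<xi> + \<zeta>) g d = LIF \<xi> g d + LIF \<zeta> g d" "LIF (r *\<^sub>R \<xi>) g d = r *\<^sub>R LIF \<xi> g d"
proof -
  obtain b where b: "b \<in> charts_at A \<one>" using ex_chart_at[OF one_closed] ..
  note lin = linear_frechet_derivative[OF LIF_component_differentiable[OF b assms(3)]]
  note comp = LIF_component[OF b assms(3)]
  show "LIF (\<xi> + \<zeta>) g d = LIF \<xi> g d + LIF \<zeta> g d"
    using comp[OF tangent_space_subspace(2)[OF smooth assms(1,2)]] comp[OF assms(1)] comp[OF assms(2)]
    by (simp add: linear_add[OF lin])
  show "LIF (r *\<^sub>R \<xi>) g d = r *\<^sub>R LIF \<xi> g d"
    using comp[OF tangent_space_subspace(3)[OF smooth assms(1)]] comp[OF assms(1)]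
    by (simp add: linear_cmul[OF lin] scaleR_fun_def)
qed

text \<open>In coordinates the field is the partial derivative of the product \<open>m\<close> in
  its second variable, taken at the identity and regarded as a function of the first. Joint
  smoothness of \<open>m\<close> makes it differentiable.\<close>

lemma LIF_differentiable:
  assumes c: "c \<in> charts_at A \<one>" and \<xi>: "\<xi> \<in> tangent_space A \<one>"
  shows "in_chart c (LIF \<xi>) differentiable (at (snd c \<one>))"
proof -
  note cA = charts_atD(1)[OF c] and c1 = charts_atD(2)[OF c]
  define m where "m = (\<lambda>(x, y). snd c (chart_inv c x \<otimes> chart_inv c y))"
  define W where "W = {(x, y). x \<in> snd c ` fst c \<and> y \<in> snd c ` fst c \<and> chart_inv c x \<otimes> chart_inv c y \<in> fst c}"
  have W: "open W" "smooth_on W m"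
    unfolding W_def m_def by (rule mult_in_charts[OF cA cA cA])+
  have ci: "chart_inv c (snd c \<one>) = \<one>" using is_chart_at[OF c] c1 by simp
  have W1: "(snd c \<one>, snd c \<one>) \<in> W" using c1 by (auto simp: W_def ci)
  define V where "V = {x. (x, snd c \<one>) \<in> W}"
  have V: "open V" "snd c \<one> \<in> V"
    using open_vimage[OF W(1), of "\<lambda>x. (x, snd c \<one>)"] W1
    by (simp_all add: V_def vimage_def continuous_on_Pair)
  define D where "D = (\<lambda>x. frechet_derivative m (at x) (0, \<xi> c))"
  have "((\<lambda>x. D (x, snd c \<one>)) has_derivative
      (\<lambda>v. frechet_derivative D (at (snd c \<one>, snd c \<one>)) (v, 0))) (at (snd c \<one>))"
  proof (rule has_derivative_compose[where f="\<lambda>x. (x, snd c \<one>)"])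
    show "((\<lambda>x. (x, snd c \<one>)) has_derivative (\<lambda>v. (v, 0))) (at (snd c \<one>))"
      by (auto intro!: derivative_eq_intros)
    show "(D has_derivative frechet_derivative D (at (snd c \<one>, snd c \<one>))) (at (snd c \<one>, snd c \<one>))"
      unfolding D_def by (rule smooth_on_has_derivative[OF smooth_on_derivative[OF W(2)] W1])
  qed
  then have "(in_chart c (LIF \<xi>) has_derivative
      (\<lambda>v. frechet_derivative D (at (snd c \<one>, snd c \<one>)) (v, 0))) (at (snd c \<one>))"
  proof (rule has_derivative_transform_within_open[OF _ V])
    fix x assume "x \<in> V"
    then have xW: "(x, snd c \<one>) \<in> W" and x: "x \<in> snd c ` fst c" by (auto simp: V_def W_def)
    have q: "chart_inv c x \<in> fst c" using chart_inv_image[OF x is_chart_at[OF c]] by auto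
    then have cq: "c \<in> charts_at A (chart_inv c x)" using cA by (simp add: charts_at_def)
    have "((\<lambda>y. m (x, y)) has_derivative (\<lambda>v. frechet_derivative m (at (x, snd c \<one>)) (0, v))) (at (snd c \<one>))"
      by (rule frechet_derivative_slice[OF smooth_on_differentiable[OF W(2) xW]])
    from fun_cong[OF frechet_derivative_at[OF this], of "\<xi> c"]
    have "D (x, snd c \<one>) = frechet_derivative (\<lambda>y. m (x, y)) (at (snd c \<one>)) (\<xi> c)"
      by (simp add: D_def)
    also have "(\<lambda>y. m (x, y)) = snd c \<circ> L (chart_inv c x) \<circ> chart_inv c"
      by (simp add: m_def left_translation_def fun_eq_iff)
    also have "frechet_derivative \<dots> (at (snd c \<one>)) (\<xi> c) = in_chart c (LIF \<xi>) x"
      using LIF_component[OF c cq \<xi>] by (simp add: in_chart_def)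
    finally show "D (x, snd c \<one>) = in_chart c (LIF \<xi>) x" .
  qed
  then show ?thesis unfolding differentiable_def by blast
qed

text \<open>The form K(v, a) of the overview: the mixed second derivative of the group product at
  the identity. It takes components in \<open>c\<close> as arguments, so that it is a bilinear map
  on Euclidean space.\<close>

definition LIF_deriv :: "('g, 'e) chart \<Rightarrow> 'e \<Rightarrow> 'e \<Rightarrow> 'e"
  where "LIF_deriv c v a = frechet_derivative (in_chart c (LIF (tvec_of \<one> c v))) (at (snd c \<one>)) a"

lemma LIF_deriv_eq:
  assumes "c \<in> charts_at A \<one>" "\<xi> \<in> tangent_space A \<one>"
  shows "frechet_derivative (in_chart c (LIF \<xi>)) (at (snd c \<one>)) a = LIF_deriv c (\<xi> c) a"
  using tvec_of_component[OF assms(2,1)] by (simp add: LIF_deriv_def)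

lemma LIF_has_derivative:
  assumes "c \<in> charts_at A \<one>" "\<xi> \<in> tangent_space A \<one>"
  shows "(in_chart c (LIF \<xi>) has_derivative LIF_deriv c (\<xi> c)) (at (snd c \<one>))"
proof -
  have "LIF_deriv c (\<xi> c) = frechet_derivative (in_chart c (LIF \<xi>)) (at (snd c \<one>))"
    using LIF_deriv_eq[OF assms] by (simp add: fun_eq_iff)
  then show ?thesis
    using LIF_differentiable[OF assms] by (simp add: frechet_derivative_works)
qed

lemma in_chart_LIF_linear:
  assumes c: "c \<in> charts_at A \<one>" and x: "x \<in> snd c ` fst c"
  shows "linear (\<lambda>v. in_chart c (LIF (tvec_of \<one> c v)) x)"
proof -
  have "chart_inv c x \<in> fst c" using chart_inv_image[OF x is_chart_at[OF c]] by auto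
  then have d: "c \<in> charts_at A (chart_inv c x)" using charts_atD(1)[OF c] by (simp add: charts_at_def)
  show ?thesis
    using LIF_linear[OF tvec_of_in_tangent_space[OF c] tvec_of_in_tangent_space[OF c] d]
    by (intro linearI) (simp_all add: in_chart_def tvec_of_linear[OF c])
qed

text \<open>In \<open>v\<close>, linear dependence of the field passes to its derivative because
  derivatives are unique. Bilinearity is needed for the product rule on K(y, y) and for the matrix
  of K(., z).\<close>

lemma LIF_deriv_bilinear:
  assumes c: "c \<in> charts_at A \<one>"
  shows "bilinear (LIF_deriv c)"
proof -
  have op: "open (snd c ` fst c)" "snd c \<one> \<in> snd c ` fst c"
    using is_chart_at[OF c] charts_atD[OF c] by (auto simp: is_chart_def)
  note H = LIF_has_derivative[OF c tvec_of_in_tangent_space[OF c], unfolded tvec_of_self[OF c]]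
  have "linear (LIF_deriv c v)" for v
    using has_derivative_linear[OF H] .
  moreover have "LIF_deriv c (u + v) a = LIF_deriv c u a + LIF_deriv c v a" for u v a
  proof -
    have "(in_chart c (LIF (tvec_of \<one> c (u + v))) has_derivative (\<lambda>a. LIF_deriv c u a + LIF_deriv c v a))
        (at (snd c \<one>))"
      by (rule has_derivative_transform_within_open[OF has_derivative_add[OF H H] op])
        (simp add: linear_add[OF in_chart_LIF_linear[OF c]])
    from has_derivative_unique[OF H this] show ?thesis by (rule fun_cong)
  qed
  moreover have "LIF_deriv c (r *\<^sub>R v) a = r *\<^sub>R LIF_deriv c v a" for r v a
  proof -
    have "(in_chart c (LIF (tvec_of \<one> c (r *\<^sub>R v))) has_derivative (\<lambda>a. r *\<^sub>R LIF_deriv c v a))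
        (at (snd c \<one>))"
      by (rule has_derivative_transform_within_open[OF has_derivative_scaleR_right[OF H] op])
        (simp add: linear_cmul[OF in_chart_LIF_linear[OF c]])
    from has_derivative_unique[OF H this] show ?thesis by (rule fun_cong)
  qed
  ultimately show ?thesis
    unfolding bilinear_def by (auto intro!: linearI)
qed

lemma lie_algebra_bracket_component:
  assumes c: "c \<in> charts_at A \<one>" and y: "y \<in> tangent_space A \<one>" and w: "w \<in> tangent_space A \<one>"
  shows "lie_algebra_bracket G A y w c = LIF_deriv c (w c) (y c) - LIF_deriv c (y c) (w c)"
  using c LIF_deriv_eq[OF c] y w
  by (simp add: lie_algebra_bracket_def lie_bracket_def LIF_one)

end

lemma (in atlas) slit_tangent_space_sum:
  fixes Z :: "'i::finite \<Rightarrow> _"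
  assumes \<xi>: "\<xi> \<in> tangent_space A p" "\<xi> \<noteq> 0"
    and Z: "\<And>i. Z i \<in> tangent_space (slit_atlas A) (p, \<xi>)"
  shows "(\<Sum>i\<in>UNIV. Z i) \<in> tangent_space (slit_atlas A) (p, \<xi>)"
proof -
  \<comment> \<open>Index types are nonempty, so some given vector can be scaled by 0.\<close>
  have zero: "0 \<in> tangent_space (slit_atlas A) (p, \<xi>)"
    using slit_tangent_space_linear(2)[OF \<xi> Z, of 0 undefined] by simp
  have "(\<Sum>i\<in>J. Z i) \<in> tangent_space (slit_atlas A) (p, \<xi>)" if "finite J" for J
    using that
  proof induction
    case (insert i J)
    show ?case
      unfolding sum.insert[OF insert.hyps]
      by (rule slit_tangent_space_linear(1)[OF \<xi> Z insert.IH])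
  qed (simp only: sum.empty zero)
  then show ?thesis by simp
qed

section \<open>Curves and fields along them\<close>

lemma (in atlas) smooth_curve_in_chart:
  assumes \<gamma>: "smooth_curve A I \<gamma>" and c: "c \<in> charts_at A (\<gamma> t)" and t: "t \<in> I"
  shows "open {s \<in> I. \<gamma> s \<in> fst c}"
    "((\<lambda>s. snd c (\<gamma> s)) has_vector_derivative velocity A \<gamma> t c) (at t)"
proof -
  \<comment> \<open>The inverse of the interval chart is the identity only on \<open>I\<close>.
    Derivatives are therefore transferred within an open subset of \<open>I\<close>, whose openness
    is part of \<open>smooth_map\<close>.\<close>
  have inv: "chart_inv (I, \<lambda>t. t) s = s" if "s \<in> I" for s :: real
    unfolding chart_inv_def by (rule inv_into_f_eq) (use that in \<open>auto simp: inj_on_def\<close>)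
  have eq: "(\<lambda>t. t) ` (I \<inter> \<gamma> -` fst c) = {s \<in> I. \<gamma> s \<in> fst c}" by auto
  have sm: "open {s \<in> I. \<gamma> s \<in> fst c} \<and>
      smooth_on {s \<in> I. \<gamma> s \<in> fst c} (snd c \<circ> \<gamma> \<circ> chart_inv (I, \<lambda>t. t))"
    using \<gamma> charts_atD(1)[OF c] unfolding smooth_curve_def smooth_map_def interval_atlas_def eq[symmetric]
    by simp
  then show o: "open {s \<in> I. \<gamma> s \<in> fst c}" ..
  have tI: "t \<in> {s \<in> I. \<gamma> s \<in> fst c}" using t charts_atD(2)[OF c] by simp
  have "((\<lambda>s. snd c (\<gamma> s)) has_derivative
      frechet_derivative (snd c \<circ> \<gamma> \<circ> chart_inv (I, \<lambda>t. t)) (at t)) (at t)"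
    by (rule has_derivative_transform_within_open[OF smooth_on_has_derivative[OF conjunct2[OF sm] tI] o tI])
      (simp add: inv)
  then have "(\<lambda>s. snd c (\<gamma> s)) differentiable (at t)"
    unfolding differentiable_def by blast
  then show "((\<lambda>s. snd c (\<gamma> s)) has_vector_derivative velocity A \<gamma> t c) (at t)"
    using c by (simp add: velocity_def vector_derivative_works)
qed

lemma (in atlas) velocity_in_tangent_space:
  assumes \<gamma>: "smooth_curve A I \<gamma>" and t: "t \<in> I"
  shows "velocity A \<gamma> t \<in> tangent_space A (\<gamma> t)"
  unfolding tangent_space_def
proof (intro CollectI conjI allI impI ballI)
  fix c d assume c: "c \<in> charts_at A (\<gamma> t)" and d: "d \<in> charts_at A (\<gamma> t)"
  note C = smooth_curve_in_chart[OF \<gamma> c t] and D = smooth_curve_in_chart[OF \<gamma> d t]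
  have tr: "((snd d \<circ> chart_inv c) has_derivative
      frechet_derivative (snd d \<circ> chart_inv c) (at (snd c (\<gamma> t)))) (at (snd c (\<gamma> t)))"
    using transition_differentiable[OF c d] by (simp add: frechet_derivative_works)
  have "((\<lambda>s. (snd d \<circ> chart_inv c) (snd c (\<gamma> s))) has_derivative
      (\<lambda>r. r *\<^sub>R frechet_derivative (snd d \<circ> chart_inv c) (at (snd c (\<gamma> t))) (velocity A \<gamma> t c))) (at t)"
    using has_derivative_compose[OF C(2)[unfolded has_vector_derivative_def] tr]
    by (simp add: linear_cmul[OF transition_linear[OF c d]])
  then have "((\<lambda>s. snd d (\<gamma> s)) has_derivative
      (\<lambda>r. r *\<^sub>R frechet_derivative (snd d \<circ> chart_inv c) (at (snd c (\<gamma> t))) (velocity A \<gamma> t c))) (at t)"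
    by (rule has_derivative_transform_within_open[OF _ C(1)])
      (use t charts_atD[OF c] is_chart_at[OF c] in auto)
  then have "((\<lambda>s. snd d (\<gamma> s)) has_vector_derivative
      frechet_derivative (snd d \<circ> chart_inv c) (at (snd c (\<gamma> t))) (velocity A \<gamma> t c)) (at t)"
    by (simp add: has_vector_derivative_def)
  with D(2) show "velocity A \<gamma> t d =
      frechet_derivative (snd d \<circ> chart_inv c) (at (snd c (\<gamma> t))) (velocity A \<gamma> t c)"
    by (rule vector_derivative_unique_at)
qed (simp add: velocity_def)

lemma (in atlas) field_along_in_chart:
  assumes Y: "smooth_nonvanishing_field_along A I \<gamma> Y" and c: "c \<in> charts_at A (\<gamma> t)" and t: "t \<in> I"
  shows "(\<lambda>s. Y s c) differentiable (at t)"
proof -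
  have inv: "chart_inv (I, \<lambda>t. t) s = s" if "s \<in> I" for s :: real
    unfolding chart_inv_def by (rule inv_into_f_eq) (use that in \<open>auto simp: inj_on_def\<close>)
  have Yt: "Y s \<in> tangent_space A (\<gamma> s)" "Y s \<noteq> 0" if "s \<in> I" for s
    using Y that by (auto simp: smooth_nonvanishing_field_along_def)
  define J where "J = (\<lambda>t. t) ` (I \<inter> (\<lambda>t. (\<gamma> t, Y t)) -` fst (slit_chart A c))"
  have k: "slit_chart A c \<in> slit_atlas A" using charts_atD(1)[OF c] by (simp add: slit_atlas_def)
  have sm: "open J" "smooth_on J (snd (slit_chart A c) \<circ> (\<lambda>t. (\<gamma> t, Y t)) \<circ> chart_inv (I, \<lambda>t. t))"
    using Y k unfolding smooth_nonvanishing_field_along_def smooth_map_def interval_atlas_def J_def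
    by simp_all
  have tO: "t \<in> J" using t Yt[OF t] charts_atD(2)[OF c] by (auto simp: J_def fst_slit_chart)
  have "((\<lambda>s. (snd c (\<gamma> s), Y s c)) has_derivative
      frechet_derivative (snd (slit_chart A c) \<circ> (\<lambda>t. (\<gamma> t, Y t)) \<circ> chart_inv (I, \<lambda>t. t)) (at t)) (at t)"
    by (rule has_derivative_transform_within_open[OF smooth_on_has_derivative[OF sm(2) tO] sm(1) tO])
      (auto simp: inv J_def)
  from has_derivative_snd[OF this] show ?thesis
    unfolding differentiable_def by auto
qed

section \<open>Sprays\<close>

lemma (in atlas) spray_in_tangent_space:
  assumes S: "spray_structure A S" and \<xi>: "\<xi> \<in> tangent_space A p" "\<xi> \<noteq> 0" and p: "p \<in> points A"
  shows "S (p, \<xi>) \<in> tangent_space (slit_atlas A) (p, \<xi>)"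
proof -
  obtain c where c: "c \<in> charts_at A p" using charts_at_nonempty[OF p] ..
  have "(p, \<xi>) \<in> points (slit_atlas A)"
    using charts_atD[OF c] \<xi> by (auto simp: points_def slit_atlas_def fst_slit_chart)
  then show ?thesis
    using S by (simp add: spray_structure_def smooth_vector_field_def)
qed

lemma (in atlas) spray_component:
  assumes S: "spray_structure A S" and \<xi>: "\<xi> \<in> tangent_space A p" "\<xi> \<noteq> 0" and c: "c \<in> charts_at A p"
  shows "S (p, \<xi>) (slit_chart A c) = (\<xi> c, - 2 *\<^sub>R spray_coeff A S c (snd c p) (\<xi> c))"
proof -
  have x: "snd c p \<in> snd c ` fst c" using charts_atD[OF c] by blast
  have nz: "\<xi> c \<noteq> 0" using component_eq_0_iff[OF \<xi>(1) c] \<xi>(2) by simp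
  have i: "in_chart (slit_chart A c) S (snd c p, \<xi> c) = S (p, \<xi>) (slit_chart A c)"
    using chart_inv_slit_chart(1)[OF charts_atD(1)[OF c] x nz] tvec_of_component[OF \<xi>(1) c]
      is_chart_at[OF c] charts_atD(2)[OF c] by (simp add: in_chart_def)
  have f: "fst (in_chart (slit_chart A c) S (snd c p, \<xi> c)) = \<xi> c"
    using S charts_atD(1)[OF c] x nz unfolding spray_structure_def by blast
  show ?thesis
    by (rule prod_eqI) (simp_all add: spray_coeff_def i f[unfolded i])
qed

text \<open>Up to the factor -1/2 the coefficients are the vertical half of a smooth map, sliced at
  the fixed base point \<open>x\<close>.\<close>

lemma (in atlas) spray_coeff_differentiable:
  assumes S: "spray_structure A S" and c: "c \<in> A" and x: "x \<in> snd c ` fst c" and y: "y \<noteq> 0"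
  shows "spray_coeff A S c x differentiable (at y)"
proof -
  have "smooth_on (snd c ` fst c \<times> (- {0})) (in_chart (slit_chart A c) S)"
    using S c unfolding spray_structure_def smooth_vector_field_def slit_chart_image[OF c, symmetric]
    by (auto simp: slit_atlas_def)
  then have "in_chart (slit_chart A c) S differentiable (at (x, y))"
    using x y by (intro smooth_on_differentiable) auto
  from has_derivative_scaleR_right[OF has_derivative_snd[OF frechet_derivative_slice[OF this]], of "- (1/2)"]
  show ?thesis
    unfolding differentiable_def spray_coeff_def[abs_def] by blast
qed

context lie_group_atlas
begin

text \<open>The bundle chart \<open>k\<close> selected by \<open>pushforward\<close> may differ from
  \<open>slit_chart A c\<close>. But the tangent map of \<open>L g\<close> followed by
  \<open>slit_chart A d\<close> coincides with \<open>slit_chart A c\<close> near \<open>v\<close>,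
  so the pushforward is the coordinate change from \<open>k\<close> to
  \<open>slit_chart A c\<close>, which the tangent vector \<open>S v\<close> obeys.\<close>

lemma spray_translated_chart:
  assumes S: "left_invariant_spray G A S" and t: "translated_chart g c d" and h: "h \<in> fst c"
    and \<xi>: "\<xi> \<in> tangent_space A h" "\<xi> \<noteq> 0"
  shows "S (g \<otimes> h, pushforward A A (L g) h \<xi>) (slit_chart A d) = S (h, \<xi>) (slit_chart A c)"
proof -
  note at = translated_charts_at[OF t h]
  note T = translated_chartD[OF t]
  define \<zeta> where "\<zeta> = pushforward A A (L g) h \<xi>"
  define v where "v = (h, \<xi>)"
  have hG: "h \<in> carrier G" by (rule charts_at_carrier[OF at(1)])
  have \<zeta>: "\<zeta> \<in> tangent_space A (g \<otimes> h)"
    unfolding \<zeta>_def by (rule left_translation_in_tangent_space[OF T(1) hG \<xi>(1)])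
  have "\<zeta> d = \<xi> c"
    unfolding \<zeta>_def by (rule left_translation_translated_chart[OF t h \<xi>(1)])
  then have \<zeta>0: "\<zeta> \<noteq> 0"
    using component_eq_0_iff[OF \<xi>(1) at(1)] \<xi>(2) by auto
  have tm: "tangent_map A A (L g) v = (g \<otimes> h, \<zeta>)"
    by (simp add: v_def \<zeta>_def tangent_map_def left_translation_def)
  have sp: "spray_structure A S" using S by (simp add: left_invariant_spray_def)
  have Sv: "S v \<in> tangent_space (slit_atlas A) v"
    unfolding v_def by (rule spray_in_tangent_space[OF sp \<xi>]) (simp add: points_eq_carrier hG)
  have cv: "slit_chart A c \<in> charts_at (slit_atlas A) v"
    using at(1) by (simp add: v_def charts_at_slit_atlas[OF \<xi>])
  then have vp: "v \<in> points (slit_atlas A)" by (auto simp: points_def charts_at_def)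
  have dv: "slit_chart A d \<in> charts_at (slit_atlas A) (g \<otimes> h, \<zeta>)"
    using at(2) by (simp add: charts_at_slit_atlas[OF \<zeta> \<zeta>0])
  define k where "k = (SOME k. k \<in> charts_at (slit_atlas A) v)"
  have kv: "k \<in> charts_at (slit_atlas A) v"
    unfolding k_def using someI[of "\<lambda>k. k \<in> charts_at (slit_atlas A) v", OF cv] .
  then obtain b where b: "b \<in> charts_at A h" and kb: "k = slit_chart A b"
    unfolding v_def charts_at_slit_atlas[OF \<xi>] by blast
  define J where "J = snd b ` (fst b \<inter> fst c) \<times> (- {0::'e})"
  have "S (g \<otimes> h, \<zeta>) (slit_chart A d) =
      frechet_derivative (snd (slit_chart A d) \<circ> tangent_map A A (L g) \<circ> chart_inv k) (at (snd k v)) (S v k)"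
  proof -
    have "pushforward (slit_atlas A) (slit_atlas A) (tangent_map A A (L g)) v (S v) = S (g \<otimes> h, \<zeta>)"
      using S vp T(1) unfolding left_invariant_spray_def tm[symmetric] by blast
    from fun_cong[OF this, of "slit_chart A d"] show ?thesis
      using dv unfolding pushforward_def tm k_def[symmetric] Let_def by simp
  qed
  also have "frechet_derivative (snd (slit_chart A d) \<circ> tangent_map A A (L g) \<circ> chart_inv k) (at (snd k v))
      = frechet_derivative (snd (slit_chart A c) \<circ> chart_inv k) (at (snd k v))"
  proof (rule frechet_derivative_cong_open)
    show "open J" unfolding J_def using transition_at(1)[OF b at(1)] by (intro open_Times) auto
    show "snd k v \<in> J"
      using transition_at(3)[OF b at(1)] component_eq_0_iff[OF \<xi>(1) b] \<xi>(2) by (simp add: J_def kb v_def)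
    fix z assume "z \<in> J"
    then obtain x y where z: "z = (x, y)" and x: "x \<in> snd b ` (fst b \<inter> fst c)" and y: "y \<noteq> 0"
      by (auto simp: J_def)
    have q: "chart_inv b x \<in> fst b \<inter> fst c"
      using chart_inv_image[OF x is_chart_at[OF b]] by auto
    define p where "p = chart_inv b x"
    have bp: "b \<in> charts_at A p" and p: "p \<in> fst c"
      using q charts_atD(1)[OF b] by (auto simp: p_def charts_at_def)
    have "chart_inv k z = (p, tvec_of p b y)"
      using chart_inv_slit_chart(1)[OF charts_atD(1)[OF b] _ y, of x] x by (auto simp: kb z p_def)
    then show "(snd (slit_chart A d) \<circ> tangent_map A A (L g) \<circ> chart_inv k) z
        = (snd (slit_chart A c) \<circ> chart_inv k) z"
      using left_translation_translated_chart[OF t p tvec_of_in_tangent_space[OF bp]] T(5)[OF p]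
      by (simp add: tangent_map_def left_translation_def)
  qed
  also have "\<dots> (S v k) = S v (slit_chart A c)"
  proof (rule sym)
    show "S v (slit_chart A c) = frechet_derivative (snd (slit_chart A c) \<circ> chart_inv k) (at (snd k v)) (S v k)"
      using Sv kv cv unfolding tangent_space_def by blast
  qed
  finally show ?thesis by (simp add: \<zeta>_def v_def)
qed

lemma spray_coeff_translated_chart:
  assumes S: "left_invariant_spray G A S" and t: "translated_chart g c d" and h: "h \<in> fst c"
    and y: "y \<noteq> 0"
  shows "spray_coeff A S d (snd c h) y = spray_coeff A S c (snd c h) y"
proof -
  note at = translated_charts_at[OF t h]
  have sp: "spray_structure A S" using S by (simp add: left_invariant_spray_def)
  define \<xi> where "\<xi> = tvec_of h c y"
  have \<xi>: "\<xi> \<in> tangent_space A h" "\<xi> c = y"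
    using tvec_of_in_tangent_space[OF at(1)] tvec_of_self[OF at(1)] by (simp_all add: \<xi>_def)
  have \<xi>0: "\<xi> \<noteq> 0" using \<xi>(2) y by auto
  define \<zeta> where "\<zeta> = pushforward A A (L g) h \<xi>"
  have \<zeta>: "\<zeta> \<in> tangent_space A (g \<otimes> h)" "\<zeta> d = y"
    using left_translation_in_tangent_space[OF translated_chartD(1)[OF t] charts_at_carrier[OF at(1)] \<xi>(1)]
      left_translation_translated_chart[OF t h \<xi>(1)] by (simp_all add: \<zeta>_def \<xi>)
  have \<zeta>0: "\<zeta> \<noteq> 0" using \<zeta>(2) y by auto
  show ?thesis
    using spray_translated_chart[OF S t h \<xi>(1) \<xi>0] spray_component[OF sp \<xi>(1) \<xi>0 at(1)]
      spray_component[OF sp \<zeta>(1) \<zeta>0 at(2)] by (simp add: \<zeta>_def[symmetric] \<zeta>(2) \<xi>(2) at(3))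
qed

end

section \<open>The connection operator in a chart\<close>

locale spray_lie_group = lie_group_atlas G A
  for G :: "('g, 'm) monoid_scheme" (structure) and A :: "('g, real^'n) chart set" +
  fixes e :: "'n \<Rightarrow> ('g, real^'n) tvec" and S :: "('g, real^'n) slit_field"
  assumes basis: "lie_algebra_basis G A e" and left_invariant: "left_invariant_spray G A S"
begin

lemma spray: "spray_structure A S"
  using left_invariant by (simp add: left_invariant_spray_def)

lemma basis_in_tangent_space: "e i \<in> tangent_space A \<one>"
  using basis span_base[of "e i" "range e"] by (simp add: lie_algebra_basis_def lie_algebra_def)

section \<open>Coordinates in the Lie algebra and the functions H\<close>

lemma ex_basis_coords:
  assumes "\<xi> \<in> tangent_space A \<one>"
  obtains u :: "real^'n" where "\<xi> = (\<Sum>i\<in>UNIV. u $ i *\<^sub>R e i)"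
proof -
  have "\<xi> \<in> span (range e)" using basis assms by (simp add: lie_algebra_basis_def lie_algebra_def)
  then obtain r where "\<xi> = (\<Sum>v\<in>range e. r v *\<^sub>R v)"
    by (auto simp: span_finite)
  also have "\<dots> = (\<Sum>i\<in>UNIV. (\<chi> i. r (e i)) $ i *\<^sub>R e i)"
    using basis by (subst sum.reindex) (simp_all add: lie_algebra_basis_def)
  finally show thesis by (rule that)
qed

lemma basis_coords_unique:
  fixes u v :: "real^'n"
  assumes "(\<Sum>i\<in>UNIV. u $ i *\<^sub>R e i) = (\<Sum>i\<in>UNIV. v $ i *\<^sub>R e i)"
  shows "u = v"
proof -
  have inj: "inj e" and ind: "independent (range e)" using basis by (auto simp: lie_algebra_basis_def)
  \<comment> \<open>Independence concerns a set of vectors, so the coefficients are reindexed by the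
    vectors themselves through \<open>inv_into\<close>.\<close>
  have "(\<Sum>x\<in>range e. (u - v) $ inv_into UNIV e x *\<^sub>R x) = (\<Sum>i\<in>UNIV. (u - v) $ i *\<^sub>R e i)"
    by (subst sum.reindex[OF inj]) (simp add: inj)
  also have "\<dots> = 0" using assms by (simp add: scaleR_left_diff_distrib sum_subtractf)
  finally have "(u - v) $ inv_into UNIV e (e i) = 0" for i
    using independentD[OF ind, of "range e" "\<lambda>x. (u - v) $ inv_into UNIV e x" "e i"] by simp
  then show ?thesis by (simp add: inj vec_eq_iff)
qed

lemma frame_one: "frame G A e i \<one> = e i"
  by (simp add: frame_def LIF_one basis_in_tangent_space)

text \<open>Only the fibre over the identity is examined, since \<open>spray_vector_field\<close>
  evaluates H there. The lifts contribute the sum of the \<open>u $ i\<close> times K(e i,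
  \<open>\<xi>\<close>), which linearity in the first argument collapses to K(\<open>\<xi>\<close>,
  \<open>\<xi>\<close>).\<close>

lemma canonical_spray_one:
  assumes \<xi>: "\<xi> \<in> tangent_space A \<one>" "\<xi> \<noteq> 0" and c: "c \<in> charts_at A \<one>"
  shows "canonical_spray G A e (\<one>, \<xi>) \<in> tangent_space (slit_atlas A) (\<one>, \<xi>)"
    "canonical_spray G A e (\<one>, \<xi>) (slit_chart A c) = (\<xi> c, LIF_deriv c (\<xi> c) (\<xi> c))"
proof -
  obtain u :: "real^'n" where u: "\<xi> = (\<Sum>i\<in>UNIV. u $ i *\<^sub>R e i)" using ex_basis_coords[OF \<xi>(1)] .
  have "frame_coords G A e (\<one>, \<xi>) = u"
    unfolding frame_coords_def snd_conv fst_conv frame_one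
  proof (rule the_equality)
    show "u' = u" if "\<xi> = (\<Sum>i\<in>UNIV. u' $ i *\<^sub>R e i)" for u'
      using that u by (intro basis_coords_unique) simp
  qed (rule u)
  then have cs: "canonical_spray G A e (\<one>, \<xi>)
      = (\<Sum>i\<in>UNIV. u $ i *\<^sub>R complete_lift A (LIF (e i)) (\<one>, \<xi>))"
    by (simp add: canonical_spray_def frame_def)
  have lift: "complete_lift A (LIF (e i)) (\<one>, \<xi>) \<in> tangent_space (slit_atlas A) (\<one>, \<xi>)" for i
    by (rule complete_lift_in_tangent_space[OF \<xi>])
      (auto intro: LIF_in_tangent_space LIF_differentiable basis_in_tangent_space simp: points_eq_carrier)
  show "canonical_spray G A e (\<one>, \<xi>) \<in> tangent_space (slit_atlas A) (\<one>, \<xi>)"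
    unfolding cs
    by (intro slit_tangent_space_sum[OF \<xi>] slit_tangent_space_linear(2)[OF \<xi>] lift)
  have comp: "complete_lift A (LIF (e i)) (\<one>, \<xi>) (slit_chart A c) = (e i c, LIF_deriv c (e i c) (\<xi> c))" for i
    using complete_lift_component[OF \<xi> c] LIF_deriv_eq[OF c basis_in_tangent_space]
    by (simp add: LIF_one basis_in_tangent_space)
  have \<xi>c: "\<xi> c = (\<Sum>i\<in>UNIV. u $ i *\<^sub>R e i c)"
    by (subst u) (simp add: tvec_sum_apply scaleR_fun_def)
  have lin: "linear (\<lambda>v. LIF_deriv c v a)" for a
    using LIF_deriv_bilinear[OF c] by (simp add: bilinear_def)
  have "LIF_deriv c (\<xi> c) a = (\<Sum>i\<in>UNIV. u $ i *\<^sub>R LIF_deriv c (e i c) a)" for a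
    unfolding \<xi>c by (simp add: linear_sum[OF lin] linear_cmul[OF lin])
  then show "canonical_spray G A e (\<one>, \<xi>) (slit_chart A c) = (\<xi> c, LIF_deriv c (\<xi> c) (\<xi> c))"
    unfolding cs by (simp add: tvec_sum_apply scaleR_fun_def comp prod_eq_iff fst_sum snd_sum \<xi>c[symmetric])
qed

text \<open>In \<open>c\<close>, the canonical spray and \<open>S\<close> have the same horizontal
  part, and their vertical parts differ by \<open>b\<close>. By \<open>iff\<close> the equation
  defining \<open>spray_H\<close> says that \<open>h\<close> gives the coordinates of the vector
  with component \<open>b\<close>: one direction evaluates at \<open>c\<close>, the other uses that
  both sides are tangent to the slit bundle.\<close>

lemma spray_vector_field_component:
  assumes \<xi>: "\<xi> \<in> tangent_space A \<one>" "\<xi> \<noteq> 0" and c: "c \<in> charts_at A \<one>"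
  shows "spray_vector_field G A e S \<xi> c
    = 2 *\<^sub>R spray_coeff A S c (snd c \<one>) (\<xi> c) + LIF_deriv c (\<xi> c) (\<xi> c)"
proof -
  define b where "b = 2 *\<^sub>R spray_coeff A S c (snd c \<one>) (\<xi> c) + LIF_deriv c (\<xi> c) (\<xi> c)"
  define V where "V = (\<lambda>h::real^'n. \<Sum>i\<in>UNIV. h $ i *\<^sub>R frame_vertical G A e i (\<one>, \<xi>))"
  define C where "C = canonical_spray G A e (\<one>, \<xi>)"
  note can = canonical_spray_one[OF \<xi> c, folded C_def]
  have v: "frame_vertical G A e i (\<one>, \<xi>) \<in> tangent_space (slit_atlas A) (\<one>, \<xi>)"
    "frame_vertical G A e i (\<one>, \<xi>) (slit_chart A c) = (0, e i c)" for i
    using vertical_velocity_in_tangent_space[OF \<xi> basis_in_tangent_space, of i]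
      vertical_velocity_component[OF \<xi> c, of "e i"] by (simp_all add: frame_vertical_def frame_one)
  have V: "V h \<in> tangent_space (slit_atlas A) (\<one>, \<xi>)" for h
    unfolding V_def
    by (intro slit_tangent_space_sum[OF \<xi>] slit_tangent_space_linear(2)[OF \<xi>] v)
  have Vh: "(\<Sum>i\<in>UNIV. h $ i *\<^sub>R frame_vertical G A e i (\<one>, \<xi>)) = V h" for h
    by (simp add: V_def)
  have Vc: "V h (slit_chart A c) = (0, (\<Sum>i\<in>UNIV. h $ i *\<^sub>R e i) c)" for h
    by (simp add: V_def tvec_sum_apply scaleR_fun_def v prod_eq_iff fst_sum snd_sum)
  have Sc: "S (\<one>, \<xi>) (slit_chart A c) = C (slit_chart A c) - (0, b)"
    by (simp add: spray_component[OF spray \<xi> c] can(2) b_def)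
  have iff: "S (\<one>, \<xi>) = C - V h \<longleftrightarrow> (\<Sum>i\<in>UNIV. h $ i *\<^sub>R e i) c = b" for h
  proof
    assume "S (\<one>, \<xi>) = C - V h"
    then have "S (\<one>, \<xi>) (slit_chart A c) = (C - V h) (slit_chart A c)" by simp
    then show "(\<Sum>i\<in>UNIV. h $ i *\<^sub>R e i) c = b" by (simp add: Sc Vc)
  next
    assume h: "(\<Sum>i\<in>UNIV. h $ i *\<^sub>R e i) c = b"
    have "C + (-1) *\<^sub>R V h \<in> tangent_space (slit_atlas A) (\<one>, \<xi>)"
      by (intro slit_tangent_space_linear[OF \<xi>] can V)
    then have "C - V h \<in> tangent_space (slit_atlas A) (\<one>, \<xi>)" by simp
    moreover have "S (\<one>, \<xi>) \<in> tangent_space (slit_atlas A) (\<one>, \<xi>)"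
      by (rule spray_in_tangent_space[OF spray \<xi>]) (simp add: points_eq_carrier)
    ultimately show "S (\<one>, \<xi>) = C - V h"
      by (intro slit_tangent_space_eqI[OF \<xi> c]) (simp_all add: Sc Vc h)
  qed
  obtain h :: "real^'n" where h: "tvec_of \<one> c b = (\<Sum>i\<in>UNIV. h $ i *\<^sub>R e i)"
    using ex_basis_coords[OF tvec_of_in_tangent_space[OF c]] .
  have hc: "(\<Sum>i\<in>UNIV. h $ i *\<^sub>R e i) c = b"
    unfolding h[symmetric] by (rule tvec_of_self[OF c])
  have "spray_H G A e S (\<one>, \<xi>) = h"
    unfolding spray_H_def C_def[symmetric] Vh iff
  proof (rule the_equality)
    show "(\<Sum>i\<in>UNIV. h $ i *\<^sub>R e i) c = b" by (rule hc)
    fix h' :: "real^'n" assume h': "(\<Sum>i\<in>UNIV. h' $ i *\<^sub>R e i) c = b"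
    have "(\<Sum>i\<in>UNIV. k $ i *\<^sub>R e i) \<in> tangent_space A \<one>" for k :: "real^'n"
      by (intro tangent_space_sum tangent_space_subspace(3) smooth basis_in_tangent_space)
    then show "h' = h"
      using tangent_space_eqI[OF _ _ c] h' hc by (intro basis_coords_unique) simp
  qed
  then show ?thesis
    using hc by (simp add: spray_vector_field_def b_def)
qed

lemma spray_vector_field_outside:
  assumes "c \<notin> charts_at A \<one>"
  shows "spray_vector_field G A e S \<xi> c = 0"
  using tangent_spaceD(1)[OF basis_in_tangent_space assms]
  by (simp add: spray_vector_field_def tvec_sum_apply scaleR_fun_def)

text \<open>Tangent vectors at the identity are padded by zero, so the parallel equation has content
  only in charts around the identity.\<close>

lemma connection_operator_outside:
  assumes "c \<notin> charts_at A \<one>"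
  shows "connection_operator G A e S y w c = 0"
  using assms
  by (simp add: connection_operator_def tvec_derivative_def spray_vector_field_outside scaleR_fun_def
      lie_algebra_bracket_def lie_bracket_def)

text \<open>Differentiating K(y, y) along \<open>w\<close> gives K(y, w) + K(w, y), and the bracket
  is K(w, y) - K(y, w). Half of the first minus half of the second leaves exactly K(y, w).\<close>

lemma connection_operator_component:
  assumes y: "y \<in> tangent_space A \<one>" "y \<noteq> 0" and w: "w \<in> tangent_space A \<one>"
    and c: "c \<in> charts_at A \<one>"
  shows "connection_operator G A e S y w c
    = frechet_derivative (spray_coeff A S c (snd c \<one>)) (at (y c)) (w c) + LIF_deriv c (y c) (w c)"
proof -
  define F where "F = spray_coeff A S c (snd c \<one>)"
  have x: "snd c \<one> \<in> snd c ` fst c" using charts_atD[OF c] by blast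
  have y0: "y c \<noteq> 0" using component_eq_0_iff[OF y(1) c] y(2) by simp
  have F: "(F has_derivative frechet_derivative F (at (y c))) (at (y c))"
    using spray_coeff_differentiable[OF spray charts_atD(1)[OF c] x y0]
    by (simp add: F_def frechet_derivative_works)
  have line: "((\<lambda>s. y c + s *\<^sub>R w c) has_vector_derivative w c) (at 0)"
    by (auto intro!: derivative_eq_intros)
  have 1: "((\<lambda>s. F (y c + s *\<^sub>R w c)) has_vector_derivative frechet_derivative F (at (y c)) (w c)) (at 0)"
    using has_derivative_compose[OF line[unfolded has_vector_derivative_def], of F "frechet_derivative F (at (y c))"] F
    by (simp add: has_vector_derivative_def linear_cmul[OF has_derivative_linear[OF F]])
  have bb: "bounded_bilinear (LIF_deriv c)"
    using LIF_deriv_bilinear[OF c] by (simp add: bilinear_conv_bounded_bilinear)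
  have 2: "((\<lambda>s. LIF_deriv c (y c + s *\<^sub>R w c) (y c + s *\<^sub>R w c)) has_vector_derivative
      LIF_deriv c (y c) (w c) + LIF_deriv c (w c) (y c)) (at 0)"
    using bounded_bilinear.has_vector_derivative[OF bb line line] by simp
  have 3: "((\<lambda>s. 2 *\<^sub>R F (y c + s *\<^sub>R w c) + LIF_deriv c (y c + s *\<^sub>R w c) (y c + s *\<^sub>R w c))
      has_vector_derivative
      2 *\<^sub>R frechet_derivative F (at (y c)) (w c) + (LIF_deriv c (y c) (w c) + LIF_deriv c (w c) (y c))) (at 0)"
    by (intro has_vector_derivative_add 2 bounded_linear.has_vector_derivative[OF bounded_linear_scaleR_right 1])
  \<comment> \<open>The formula for the spray vector field concerns nonzero vectors. Its argument
    stays nonzero for \<open>s\<close> near 0 because its component in \<open>c\<close>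
    does.\<close>
  have op: "open {s. y c + s *\<^sub>R w c \<noteq> 0}"
    by (intro open_Collect_neq continuous_intros)
  have "((\<lambda>s. spray_vector_field G A e S (y + s *\<^sub>R w) c) has_vector_derivative
      2 *\<^sub>R frechet_derivative F (at (y c)) (w c) + (LIF_deriv c (y c) (w c) + LIF_deriv c (w c) (y c))) (at 0)"
  proof (rule has_vector_derivative_transform_within_open[OF 3 op])
    show "0 \<in> {s. y c + s *\<^sub>R w c \<noteq> 0}" using y0 by simp
    fix s assume s: "s \<in> {s. y c + s *\<^sub>R w c \<noteq> 0}"
    have m: "y + s *\<^sub>R w \<in> tangent_space A \<one>"
      by (intro tangent_space_subspace[OF smooth] y w)
    have ec: "(y + s *\<^sub>R w) c = y c + s *\<^sub>R w c" by (simp add: scaleR_fun_def)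
    have "y + s *\<^sub>R w \<noteq> 0"
    proof
      assume "y + s *\<^sub>R w = 0"
      from fun_cong[OF this, of c] show False using s unfolding ec by simp
    qed
    from spray_vector_field_component[OF m this c]
    show "2 *\<^sub>R F (y c + s *\<^sub>R w c) + LIF_deriv c (y c + s *\<^sub>R w c) (y c + s *\<^sub>R w c)
        = spray_vector_field G A e S (y + s *\<^sub>R w) c"
      unfolding ec F_def by simp
  qed
  from vector_derivative_at[OF this]
  have "connection_operator G A e S y w c = (1/2) *\<^sub>R
      (2 *\<^sub>R frechet_derivative F (at (y c)) (w c) + (LIF_deriv c (y c) (w c) + LIF_deriv c (w c) (y c)))
      - (1/2) *\<^sub>R (LIF_deriv c (w c) (y c) - LIF_deriv c (y c) (w c))"
    using lie_algebra_bracket_component[OF c y(1) w]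
    by (simp add: connection_operator_def tvec_derivative_def scaleR_fun_def)
  also have "\<dots> = frechet_derivative F (at (y c)) (w c)
      + ((1/2) *\<^sub>R LIF_deriv c (y c) (w c) + (1/2) *\<^sub>R LIF_deriv c (y c) (w c))"
    by (simp add: algebra_simps)
  finally show ?thesis by (simp add: F_def scaleR_left_distrib[symmetric])
qed

text \<open>The derivative \<open>v\<close> of the translated field is obtained and not assumed, and
  it is obtained for one pair of matching charts at a time. Matching makes the components at
  \<open>\<gamma> t\<close> in \<open>k\<close> equal to those at the identity in
  \<open>d\<close>.\<close>

lemma nonlinear_covariant_deriv_translated_chart:
  assumes I: "open I" "t \<in> I" and \<gamma>: "smooth_curve A I \<gamma>"
    and Y: "smooth_nonvanishing_field_along A I \<gamma> Y"
    and w: "w = pushforward A A (L (inv (\<gamma> t))) (\<gamma> t) (velocity A \<gamma> t)"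
    and y: "\<And>s. s \<in> I \<Longrightarrow> y s = pushforward A A (L (inv (\<gamma> s))) (\<gamma> s) (Y s)"
    and tr: "translated_chart (\<gamma> t) d k" and d1: "\<one> \<in> fst d"
  obtains v where "((\<lambda>s. y s d) has_vector_derivative v) (at t)"
    "nonlinear_covariant_deriv A S \<gamma> Y t k = v + connection_operator G A e S (y t) w d"
proof -
  define g where "g = \<gamma> t"
  have \<gamma>G: "\<gamma> s \<in> carrier G" if "s \<in> I" for s
    using \<gamma> that unfolding smooth_curve_def smooth_map_def points_eq_carrier
    by (auto simp: points_def interval_atlas_def)
  have g: "g \<in> carrier G" using \<gamma>G[OF I(2)] by (simp add: g_def)
  note tr = tr[folded g_def] and trs = translated_chart_sym[OF tr[folded g_def]]
  have d: "d \<in> charts_at A \<one>" and k: "k \<in> charts_at A g" and kg: "snd k g = snd d \<one>"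
    using translated_charts_at[OF tr d1] g by simp_all
  have gk: "g \<in> fst k" by (rule charts_atD(2)[OF k])
  have YT: "Y s \<in> tangent_space A (\<gamma> s)" "Y s \<noteq> 0" if "s \<in> I" for s
    using Y that by (auto simp: smooth_nonvanishing_field_along_def)
  have yT: "y s \<in> tangent_space A \<one>" if "s \<in> I" for s
    using left_translation_in_tangent_space[OF _ \<gamma>G[OF that] YT(1)[OF that], of "inv (\<gamma> s)"] \<gamma>G[OF that]
    by (simp add: y[OF that])
  have velT: "velocity A \<gamma> t \<in> tangent_space A g"
    unfolding g_def by (rule velocity_in_tangent_space[OF \<gamma> I(2)])
  have wT: "w \<in> tangent_space A \<one>"
    using left_translation_in_tangent_space[OF _ g velT, of "inv g"] g by (simp add: w g_def[symmetric])
  define z where "z = velocity A \<gamma> t k"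
  have wz: "w d = z"
    using left_translation_translated_chart[OF trs gk velT] by (simp add: w g_def z_def)
  have yY: "y t d = Y t k"
    using left_translation_translated_chart[OF trs gk YT(1)[OF I(2), folded g_def]]
    by (simp add: y[OF I(2)] g_def)
  have Yk0: "Y t k \<noteq> 0"
    using component_eq_0_iff[OF YT(1)[OF I(2)], of k] YT(2)[OF I(2)] k by (simp add: g_def)
  have y0: "y t \<noteq> 0" using Yk0 yY by auto
  define J where "J = {s \<in> I. \<gamma> s \<in> fst k}"
  have J: "open J" "t \<in> J"
    using smooth_curve_in_chart(1)[OF \<gamma> k[unfolded g_def] I(2)] I(2) gk by (auto simp: J_def g_def)
  define x where "x = (\<lambda>s. snd k (\<gamma> s))"
  have x: "(x has_vector_derivative z) (at t)"
    unfolding x_def z_def by (rule smooth_curve_in_chart(2)[OF \<gamma> k[unfolded g_def] I(2)])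
  have xt: "x t = snd d \<one>" using kg by (simp add: x_def g_def)
  define Y' where "Y' = vector_derivative (\<lambda>s. Y s k) (at t)"
  have Y': "((\<lambda>s. Y s k) has_vector_derivative Y') (at t)"
    using field_along_in_chart[OF Y k[unfolded g_def] I(2)] by (simp add: Y'_def vector_derivative_works)
  \<comment> \<open>The overview's Phi(x) v; \<open>M s\<close> is its matrix at the point
    \<open>x s\<close> of the curve.\<close>
  define f where "f = (\<lambda>v x. in_chart d (LIF (tvec_of \<one> d v)) x)"
  define M where "M = (\<lambda>s. matrix (\<lambda>v. f v (x s)))"
  define M' where "M' = matrix (\<lambda>v. LIF_deriv d v z)"
  \<comment> \<open>The translation is by the fixed \<open>g\<close> while \<open>s\<close> varies:
    \<open>inv g \<otimes> \<gamma> s\<close> is a curve through the identity with the coordinates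
    in \<open>d\<close> that \<open>\<gamma> s\<close> has in \<open>k\<close>.\<close>
  have xd: "x s \<in> snd d ` fst d" "chart_inv d (x s) = inv g \<otimes> \<gamma> s" if "s \<in> J" for s
    using translated_chart_inv[OF trs, of "x s"] that is_chart_at[OF k] by (auto simp: x_def J_def)
  have M: "((\<lambda>s. M s $ i $ j) has_real_derivative M' $ i $ j) (at t)" for i j
  proof -
    \<comment> \<open>The \<open>j\<close>-th column of \<open>M\<close> is one left invariant field
      evaluated along the curve, so its derivative at \<open>t\<close> is K(axis j 1, z).\<close>
    have D: "(f (axis j 1) has_derivative LIF_deriv d (axis j 1)) (at (x t))"
      using LIF_has_derivative[OF d tvec_of_in_tangent_space[OF d]] by (simp add: f_def xt d)
    have "((\<lambda>s. f (axis j 1) (x s)) has_vector_derivative LIF_deriv d (axis j 1) z) (at t)"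
      using has_derivative_compose[OF x[unfolded has_vector_derivative_def] D]
      by (simp add: has_vector_derivative_def linear_cmul[OF has_derivative_linear[OF D]])
    from bounded_linear.has_vector_derivative[OF bounded_linear_vec_nth this, of i] show ?thesis
      by (simp add: has_real_derivative_iff_has_vector_derivative M_def M'_def matrix_def)
  qed
  have "f v (x t) = v" for v
    using LIF_one[OF tvec_of_in_tangent_space[OF d]] is_chart_at[OF d] d1
    by (simp add: f_def xt in_chart_def d)
  then have Mt: "M t = mat 1" by (simp add: M_def matrix_id_mat_1[unfolded id_def])
  have YM: "Y s k = M s *v y s d" if s: "s \<in> J" for s
  proof -
    have sI: "s \<in> I" and sk: "\<gamma> s \<in> fst k" using s by (auto simp: J_def)
    have h: "inv g \<otimes> \<gamma> s \<in> fst d"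
      using translated_charts_at(2)[OF trs sk] by (rule charts_atD(2))
    have gh: "g \<otimes> (inv g \<otimes> \<gamma> s) = \<gamma> s" using g \<gamma>G[OF sI] by (simp add: m_assoc[symmetric])
    \<comment> \<open>The vector is first written as a left invariant field at
      \<open>\<gamma> s\<close> and then moved by \<open>inv g\<close> into the domain of
      \<open>d\<close>, which leaves the component unchanged.\<close>
    have "Y s k = LIF (y s) (\<gamma> s) k"
      using LIF_left_translation[OF \<gamma>G[OF sI] YT(1)[OF sI]] by (simp add: y[OF sI])
    also have "\<dots> = LIF (y s) (inv g \<otimes> \<gamma> s) d"
      using LIF_translated_chart[OF tr h yT[OF sI]] gh by simp
    also have "\<dots> = f (y s d) (x s)"
      using tvec_of_component[OF yT[OF sI] d] by (simp add: f_def in_chart_def xd(2)[OF s])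
    also have "\<dots> = M s *v y s d"
      using fun_cong[OF matrix_vector_mul(2)[OF in_chart_LIF_linear[OF d xd(1)[OF s]]]] by (simp add: M_def f_def)
    finally show ?thesis .
  qed
  have yd: "((\<lambda>s. y s d) has_vector_derivative Y' - M' *v y t d) (at t)"
    by (rule linear_system_has_vector_derivative[OF M Mt J YM Y'])
  have M'y: "M' *v y t d = LIF_deriv d (y t d) z"
    unfolding M'_def using LIF_deriv_bilinear[OF d] by (intro fun_cong[OF matrix_vector_mul(2)]) (simp add: bilinear_def)
  define F where "F = spray_coeff A S k (snd k g)"
  have xk: "snd k g \<in> snd k ` fst k" using gk by blast
  have F: "(F has_derivative frechet_derivative F (at (Y t k))) (at (Y t k))"
    using spray_coeff_differentiable[OF spray charts_atD(1)[OF k] xk Yk0]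
    by (simp add: F_def frechet_derivative_works)
  \<comment> \<open>The coefficients are compared for nonzero fibre vectors. This set is open and
    contains \<open>Y t k\<close>, so the derivatives there agree.\<close>
  have Fd: "frechet_derivative F (at (Y t k)) = frechet_derivative (spray_coeff A S d (snd d \<one>)) (at (y t d))"
    unfolding yY
  proof (rule frechet_derivative_cong_open[of "- {0}"])
    show "F u = spray_coeff A S d (snd d \<one>) u" if "u \<in> - {0}" for u
      using spray_coeff_translated_chart[OF left_invariant tr d1] that by (simp add: F_def kg)
  qed (use Yk0 in auto)
  have N: "spray_N A S k (snd k g) (Y t k) i j = frechet_derivative F (at (Y t k)) (axis j 1) $ i" for i j
  proof -
    have "((\<lambda>u. F u $ i) has_derivative (\<lambda>v. frechet_derivative F (at (Y t k)) v $ i)) (at (Y t k))"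
      by (rule bounded_linear.has_derivative[OF bounded_linear_vec_nth F])
    from fun_cong[OF frechet_derivative_at[OF this], of "axis j 1"] show ?thesis
      by (simp add: spray_N_def F_def)
  qed
  have "nonlinear_covariant_deriv A S \<gamma> Y t k = Y' + frechet_derivative F (at (Y t k)) z"
  proof (rule vec_eq_iff[THEN iffD2, rule_format])
    fix i
    have "((\<lambda>s. Y s k $ i) has_real_derivative Y' $ i) (at t)"
      using bounded_linear.has_vector_derivative[OF bounded_linear_vec_nth Y']
      by (simp add: has_real_derivative_iff_has_vector_derivative)
    then have "deriv (\<lambda>s. Y s k $ i) t = Y' $ i" by (rule DERIV_imp_deriv)
    \<comment> \<open>The N with indices i, j are the matrix entries of the fibre derivative of the
      coefficients, so contracting with the velocity \<open>z\<close> gives the derivative in that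
      direction.\<close>
    moreover have "(\<Sum>j\<in>UNIV. z $ j * frechet_derivative F (at (Y t k)) (axis j 1) $ i)
        = frechet_derivative F (at (Y t k)) z $ i"
      using fun_cong[OF matrix_vector_mul(2)[OF has_derivative_linear[OF F]], of z]
      by (simp add: matrix_def matrix_vector_mult_def vec_eq_iff mult.commute)
    ultimately show "nonlinear_covariant_deriv A S \<gamma> Y t k $ i
        = (Y' + frechet_derivative F (at (Y t k)) z) $ i"
      using k by (simp add: nonlinear_covariant_deriv_def N[unfolded g_def] z_def g_def)
  qed
  also have "\<dots> = (Y' - M' *v y t d) + connection_operator G A e S (y t) w d"
    using connection_operator_component[OF yT[OF I(2)] y0 wT d] by (simp add: M'y Fd wz)
  finally show thesis using yd by (rule that[rotated])
qed

end

section \<open>From matching charts to all charts\<close>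

theorem theorem1p4:
  fixes G :: "('g, 'm) monoid_scheme"
    and A :: "('g, real^'n) chart set"
    and e :: "'n \<Rightarrow> ('g, real^'n) tvec"
    and S :: "('g, real^'n) slit_field"
    and I :: "real set"
    and c :: "real \<Rightarrow> 'g"
    and Y w y :: "real \<Rightarrow> ('g, real^'n) tvec"
  assumes "lie_group G A"
    and "connected_space (atlas_topology A)"
    and "lie_algebra_basis G A e"
    and "left_invariant_spray G A S"
    and "open I" and "is_interval I"
    and "smooth_curve A I c"
    and "smooth_nonvanishing_field_along A I c Y"
    and "\<And>t. t \<in> I \<Longrightarrow>
      w t = pushforward A A (left_translation G (inv\<^bsub>G\<^esub> (c t))) (c t) (velocity A c t)"
    and "\<And>t. t \<in> I \<Longrightarrow>
      y t = pushforward A A (left_translation G (inv\<^bsub>G\<^esub> (c t))) (c t) (Y t)"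
  shows "nonlinearly_parallel A S I c Y \<longleftrightarrow>
    (\<forall>t\<in>I. \<exists>y'. has_tvec_derivative y y' t \<and>
       y' + connection_operator G A e S (y t) (w t) = 0)"
proof -
  interpret spray_lie_group G A e S
    by unfold_locales (fact assms)+
  have "nonlinear_covariant_deriv A S c Y t = 0 \<longleftrightarrow>
      (\<exists>y'. has_tvec_derivative y y' t \<and> y' + connection_operator G A e S (y t) (w t) = 0)"
    if t: "t \<in> I" for t
  proof -
    \<comment> \<open>A total definition made before differentiability is known; \<open>pair\<close>
      and \<open>outside\<close> then show that it is the derivative in every chart.\<close>
    define y' where "y' = tvec_derivative y t"
    define E where "E = y' + connection_operator G A e S (y t) (w t)"
    have cG: "c s \<in> carrier G" if "s \<in> I" for s
      using assms(7) that unfolding smooth_curve_def smooth_map_def points_eq_carrier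
      by (auto simp: points_def interval_atlas_def)
    have pair: "((\<lambda>s. y s d) has_vector_derivative y' d) (at t)"
      "nonlinear_covariant_deriv A S c Y t k = E d"
      if tr: "translated_chart (c t) d k" and d1: "\<one>\<^bsub>G\<^esub> \<in> fst d" for d k
    proof -
      obtain v where v: "((\<lambda>s. y s d) has_vector_derivative v) (at t)"
        "nonlinear_covariant_deriv A S c Y t k = v + connection_operator G A e S (y t) (w t) d"
        using nonlinear_covariant_deriv_translated_chart[OF assms(5) t assms(7,8) assms(9)[OF t]
            assms(10) tr d1] .
      have "y' d = v"
        using vector_derivative_at[OF v(1)] by (simp add: y'_def tvec_derivative_def)
      with v show "((\<lambda>s. y s d) has_vector_derivative y' d) (at t)"
        "nonlinear_covariant_deriv A S c Y t k = E d" by (simp_all add: E_def)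
    qed
    have outside: "((\<lambda>s. y s d) has_vector_derivative 0) (at t)" "y' d = 0" "E d = 0"
      if d: "d \<notin> charts_at A \<one>\<^bsub>G\<^esub>" for d
    proof -
      have yd: "y s d = 0" if "s \<in> I" for s
      proof -
        have "Y s \<in> tangent_space A (c s)"
          using assms(8) that by (simp add: smooth_nonvanishing_field_along_def)
        then have "y s \<in> tangent_space A \<one>\<^bsub>G\<^esub>"
          using left_translation_in_tangent_space[OF _ cG[OF that], of "inv\<^bsub>G\<^esub> (c s)"] cG[OF that]
          by (simp add: assms(10)[OF that])
        then show ?thesis using d by (rule tangent_spaceD(1))
      qed
      show v: "((\<lambda>s. y s d) has_vector_derivative 0) (at t)"
        by (rule has_vector_derivative_transform_within_open[OF has_vector_derivative_const assms(5) t])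
          (simp add: yd)
      show "y' d = 0"
        using vector_derivative_at[OF v] by (simp add: y'_def tvec_derivative_def)
      then show "E d = 0" by (simp add: E_def connection_operator_outside[OF d])
    qed
    have "has_tvec_derivative y y' t"
      unfolding has_tvec_derivative_def
    proof
      fix d
      show "((\<lambda>s. y s d) has_vector_derivative y' d) (at t)"
      proof (cases "d \<in> charts_at A \<one>\<^bsub>G\<^esub>")
        case True
        obtain k where "translated_chart (c t) d k"
          using ex_translated_chart[OF cG[OF t] charts_atD(1)[OF True]] .
        then show ?thesis using charts_atD(2)[OF True] by (rule pair(1))
      next
        case False
        then show ?thesis using outside(1,2)[OF False] by simp
      qed
    qed
    \<comment> \<open>Uniqueness of derivatives turns the existential statement into the single
      equation \<open>E = 0\<close>.\<close>
    moreover have "z = y'" if "has_tvec_derivative y z t" for z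
      using that by (auto simp: has_tvec_derivative_def y'_def tvec_derivative_def fun_eq_iff
          intro: vector_derivative_at[symmetric])
    ultimately have "(\<exists>y'. has_tvec_derivative y y' t \<and>
        y' + connection_operator G A e S (y t) (w t) = 0) \<longleftrightarrow> E = 0"
      unfolding E_def by blast
    moreover have "nonlinear_covariant_deriv A S c Y t = 0 \<longleftrightarrow> E = 0"
    proof
      assume n: "nonlinear_covariant_deriv A S c Y t = 0"
      show "E = 0"
      proof
        fix d
        show "E d = 0 d"
        proof (cases "d \<in> charts_at A \<one>\<^bsub>G\<^esub>")
          case True
          obtain k where "translated_chart (c t) d k"
            \<comment> \<open>Charts around the identity are pushed to \<open>c t\<close> in this
              direction; in the converse, charts around \<open>c t\<close> are pulled back.\<close>
            using ex_translated_chart[OF cG[OF t] charts_atD(1)[OF True]] .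
          from pair(2)[OF this charts_atD(2)[OF True]] n show ?thesis by simp
        qed (simp add: outside(3))
      qed
    next
      assume E: "E = 0"
      show "nonlinear_covariant_deriv A S c Y t = 0"
      proof
        fix k
        show "nonlinear_covariant_deriv A S c Y t k = 0 k"
        proof (cases "k \<in> charts_at A (c t)")
          case True
          obtain d where d: "translated_chart (c t) d k"
            using ex_translated_chart'[OF cG[OF t] charts_atD(1)[OF True]] .
          \<comment> \<open>The point \<open>c t\<close> lies in \<open>k\<close>, so its translate,
            the identity, lies in \<open>d\<close>, as \<open>pair\<close> requires.\<close>
          have "inv\<^bsub>G\<^esub> (c t) \<otimes>\<^bsub>G\<^esub> c t \<in> fst d"
            using translated_charts_at(2)[OF translated_chart_sym[OF d] charts_atD(2)[OF True]]
            by (rule charts_atD(2))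
          then have "\<one>\<^bsub>G\<^esub> \<in> fst d" using cG[OF t] by simp
          from pair(2)[OF d this] E show ?thesis by simp
        qed (simp add: nonlinear_covariant_deriv_def)
      qed
    qed
    ultimately show ?thesis by blast
  qed
  then show ?thesis
    unfolding nonlinearly_parallel_def by blast
qed

end
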